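(* There exists a bounded linear operator $T$ on the complex Hilbert space $\ell^2$ such that $T$ is mixing, $T$ is chaotic, and the pair $(T,T^2)$ is not $d$-syndetic.
   Context: For a bounded linear operator $T$ on $X$ and non-empty open sets $U,V\subseteq X$, let $N(U,V)=\{n\ge 0: T^n(U)\cap V\ne\emptyset\}$. $T$ is mixing if $N(U,V)$ is cofinite for all non-empty open $U,V$. $T$ is hypercyclic if some vector $x$ has dense orbit $\{T^nx:n\ge 0\}$. A point $x$ is periodic for $T$ if $T^kx=x$ for some $k\ge 1$. $T$ is chaotic if it is hypercyclic and its set of periodic points is dense. A set $A\subseteq\mathbb{N}$ is syndetic if it is infinite and has bounded gaps, i.e. if $A=\{x_1<x_2<\dots\}$ then there is $M>0$ with $x_{n+1}-x_n<M$ for all $n$. A tuple of operators $(T_1,\dots,T_N)$ on $X$ is $d$-syndetic if for all non-empty open sets $U_0,U_1,\dots,U_N\subseteq X$ the set $\{k\ge 0: T_1^{-k}(U_1)\cap\dots\cap T_N^{-k}(U_N)\cap U_0\ne\emptyset\}$ is syndetic. *)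

theory Defs
  imports "HOL-Analysis.Analysis"
begin

section \<open>The complex sequence space \<open>\<ell>\<^sup>2\<close>\<close>

definition square_summable :: "(nat \<Rightarrow> complex) \<Rightarrow> bool" where
  "square_summable f \<longleftrightarrow> summable (\<lambda>n. (cmod (f n))\<^sup>2)"

lemma square_summable_zero: "square_summable (\<lambda>n. 0)"
  by (simp add: square_summable_def)

lemma square_summable_add:
  assumes "square_summable f" "square_summable g"
  shows "square_summable (\<lambda>n. f n + g n)"
  unfolding square_summable_def
proof (rule summable_comparison_test')
  show "summable (\<lambda>n. 2 * (cmod (f n))\<^sup>2 + 2 * (cmod (g n))\<^sup>2)"
    using assms unfolding square_summable_def by (intro summable_add summable_mult)
next
  fix n :: nat
  have "(cmod (f n + g n))\<^sup>2 \<le> (cmod (f n) + cmod (g n))\<^sup>2"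
    by (intro power_mono norm_triangle_ineq) auto
  also have "\<dots> \<le> 2 * (cmod (f n))\<^sup>2 + 2 * (cmod (g n))\<^sup>2"
    using sum_squares_bound[of "cmod (f n)" "cmod (g n)"] by (simp add: power2_sum)
  finally show "norm ((cmod (f n + g n))\<^sup>2) \<le> 2 * (cmod (f n))\<^sup>2 + 2 * (cmod (g n))\<^sup>2"
    by simp
qed

lemma square_summable_mult:
  assumes "square_summable f"
  shows "square_summable (\<lambda>n. c * f n)"
  using assms unfolding square_summable_def
  by (simp add: norm_mult power_mult_distrib summable_mult)

lemma square_summable_uminus:
  "square_summable f \<Longrightarrow> square_summable (\<lambda>n. - f n)"
  by (simp add: square_summable_def)

lemma square_summable_diff:
  "square_summable f \<Longrightarrow> square_summable g \<Longrightarrow> square_summable (\<lambda>n. f n - g n)"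
  using square_summable_add[of f "\<lambda>n. - g n"] by (simp add: square_summable_uminus)

lemma square_summable_inner:
  assumes "square_summable f" "square_summable g"
  shows "summable (\<lambda>n. f n \<bullet> g n)"
proof (rule summable_comparison_test')
  show "summable (\<lambda>n. (cmod (f n))\<^sup>2 + (cmod (g n))\<^sup>2)"
    using assms unfolding square_summable_def by (intro summable_add)
next
  fix n :: nat
  have "2 * (cmod (f n) * cmod (g n)) \<le> (cmod (f n))\<^sup>2 + (cmod (g n))\<^sup>2"
    using sum_squares_bound[of "cmod (f n)" "cmod (g n)"] by (simp add: mult.assoc)
  moreover have "0 \<le> cmod (f n) * cmod (g n)" by simp
  moreover have "\<bar>f n \<bullet> g n\<bar> \<le> cmod (f n) * cmod (g n)"
    by (rule Cauchy_Schwarz_ineq2)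
  ultimately show "norm (f n \<bullet> g n) \<le> (cmod (f n))\<^sup>2 + (cmod (g n))\<^sup>2"
    unfolding real_norm_def by linarith
qed

typedef ell2 = "{f. square_summable f}"
  morphisms coord Abs_ell2
  using square_summable_zero by auto

setup_lifting type_definition_ell2

lemma square_summable_coord: "square_summable (coord x)"
  using coord by auto

lemma ell2_eqI: "(\<And>n. coord x n = coord y n) \<Longrightarrow> x = y"
  by (simp add: coord_inject[symmetric] ext)

lift_definition scaleC_ell2 :: "complex \<Rightarrow> ell2 \<Rightarrow> ell2"  (infixr \<open>*\<^sub>C\<close> 75)
  is "\<lambda>c f n. c * f n"
  by (rule square_summable_mult)

instantiation ell2 :: real_vector
begin

lift_definition zero_ell2 :: ell2 is "\<lambda>n. 0"
  by (rule square_summable_zero)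

lift_definition plus_ell2 :: "ell2 \<Rightarrow> ell2 \<Rightarrow> ell2" is "\<lambda>f g n. f n + g n"
  by (rule square_summable_add)

lift_definition uminus_ell2 :: "ell2 \<Rightarrow> ell2" is "\<lambda>f n. - f n"
  by (rule square_summable_uminus)

lift_definition minus_ell2 :: "ell2 \<Rightarrow> ell2 \<Rightarrow> ell2" is "\<lambda>f g n. f n - g n"
  by (rule square_summable_diff)

definition scaleR_ell2 :: "real \<Rightarrow> ell2 \<Rightarrow> ell2" where
  "scaleR_ell2 r x = complex_of_real r *\<^sub>C x"

instance
  by standard
    (auto intro!: ell2_eqI simp: scaleR_ell2_def scaleC_ell2.rep_eq zero_ell2.rep_eq plus_ell2.rep_eq
      uminus_ell2.rep_eq minus_ell2.rep_eq algebra_simps)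

end

lemma coord_scaleR [simp]: "coord (r *\<^sub>R x) n = r *\<^sub>R coord x n"
  by (simp add: scaleR_ell2_def scaleC_ell2.rep_eq scaleR_conv_of_real)

lemmas coord_simps [simp] =
  scaleC_ell2.rep_eq zero_ell2.rep_eq plus_ell2.rep_eq uminus_ell2.rep_eq minus_ell2.rep_eq

lemma vector_space_scaleC_ell2: "vector_space scaleC_ell2"
  by standard (auto intro!: ell2_eqI simp: algebra_simps)

instantiation ell2 :: real_inner
begin

text \<open>The real part of the complex inner product \<open>\<Sum>n. x n * cnj (y n)\<close>; both induce the same norm.\<close>

definition inner_ell2 :: "ell2 \<Rightarrow> ell2 \<Rightarrow> real" where
  "inner_ell2 x y = (\<Sum>n. coord x n \<bullet> coord y n)"

definition norm_ell2 :: "ell2 \<Rightarrow> real" where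
  "norm_ell2 x = sqrt (\<Sum>n. (cmod (coord x n))\<^sup>2)"

definition sgn_ell2 :: "ell2 \<Rightarrow> ell2" where
  "sgn_ell2 x = x /\<^sub>R norm x"

definition dist_ell2 :: "ell2 \<Rightarrow> ell2 \<Rightarrow> real" where
  "dist_ell2 x y = norm (x - y)"

definition uniformity_ell2 :: "(ell2 \<times> ell2) filter" where
  "uniformity_ell2 = (INF e\<in>{0<..}. principal {(x, y). dist x y < e})"

definition open_ell2 :: "ell2 set \<Rightarrow> bool" where
  "open_ell2 U \<longleftrightarrow> (\<forall>x\<in>U. \<forall>\<^sub>F (x', y) in uniformity. x' = x \<longrightarrow> y \<in> U)"

instance
proof
  fix x y z :: ell2 and r :: real
  have summ: "summable (\<lambda>n. coord u n \<bullet> coord v n)" for u v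
    by (intro square_summable_inner square_summable_coord)
  show "x \<bullet> y = y \<bullet> x"
    by (simp add: inner_ell2_def inner_commute)
  show "(x + y) \<bullet> z = x \<bullet> z + y \<bullet> z"
    by (simp add: inner_ell2_def inner_add_left suminf_add summ)
  show "(r *\<^sub>R x) \<bullet> y = r * (x \<bullet> y)"
    by (simp add: inner_ell2_def suminf_mult summ)
  show "0 \<le> x \<bullet> x"
    unfolding inner_ell2_def by (intro suminf_nonneg summ) simp
  show "x \<bullet> x = 0 \<longleftrightarrow> x = 0"
  proof
    assume "x \<bullet> x = 0"
    then have "\<forall>n. coord x n \<bullet> coord x n = 0"
      unfolding inner_ell2_def by (subst (asm) suminf_eq_zero_iff) (auto intro: summ)
    then show "x = 0" by (auto intro!: ell2_eqI)
  qed (simp add: inner_ell2_def)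
  show "norm x = sqrt (x \<bullet> x)"
    by (simp add: norm_ell2_def inner_ell2_def power2_norm_eq_inner)
qed (simp_all only: sgn_ell2_def dist_ell2_def uniformity_ell2_def open_ell2_def)

end

lemma norm_ell2_power2: "(norm (x :: ell2))\<^sup>2 = (\<Sum>n. (cmod (coord x n))\<^sup>2)"
proof -
  have "0 \<le> (\<Sum>n. (cmod (coord x n))\<^sup>2)"
    using square_summable_coord[of x] unfolding square_summable_def by (intro suminf_nonneg) auto
  then show ?thesis by (simp add: norm_ell2_def)
qed

lemma sum_coord_le_norm: "(\<Sum>n<k. (cmod (coord x n))\<^sup>2) \<le> (norm x)\<^sup>2"
  unfolding norm_ell2_power2 using square_summable_coord[of x] unfolding square_summable_def
  by (intro sum_le_suminf) auto

lemma norm_coord_le: "cmod (coord x n) \<le> norm x"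
proof -
  have "(cmod (coord x n))\<^sup>2 \<le> (\<Sum>i<Suc n. (cmod (coord x i))\<^sup>2)"
    by (simp add: sum_nonneg)
  also have "\<dots> \<le> (norm x)\<^sup>2" by (rule sum_coord_le_norm)
  finally show ?thesis by (rule power2_le_imp_le) simp
qed

instance ell2 :: banach
proof
  fix X :: "nat \<Rightarrow> ell2"
  assume "Cauchy X"
  have "Cauchy (\<lambda>m. coord (X m) n)" for n
  proof (rule metric_CauchyI)
    fix e :: real assume "0 < e"
    then obtain M where M: "\<And>m k. m \<ge> M \<Longrightarrow> k \<ge> M \<Longrightarrow> dist (X m) (X k) < e"
      using metric_CauchyD[OF \<open>Cauchy X\<close> \<open>0 < e\<close>] by blast
    have "dist (coord (X m) n) (coord (X k) n) < e" if "m \<ge> M" "k \<ge> M" for m k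
      using M[OF that] norm_coord_le[of "X m - X k" n] by (simp add: dist_norm)
    then show "\<exists>M. \<forall>m\<ge>M. \<forall>k\<ge>M. dist (coord (X m) n) (coord (X k) n) < e" by blast
  qed
  then have "\<forall>n. \<exists>l. (\<lambda>m. coord (X m) n) \<longlonglongrightarrow> l"
    by (simp add: Cauchy_convergent_iff convergent_def)
  then obtain f where f: "\<And>n. (\<lambda>m. coord (X m) n) \<longlonglongrightarrow> f n" by metis
  have tail: "\<exists>M. \<forall>m\<ge>M. \<forall>K. (\<Sum>n<K. (cmod (coord (X m) n - f n))\<^sup>2) \<le> e\<^sup>2" if "0 < e" for e
  proof -
    obtain M where M: "\<And>m k. m \<ge> M \<Longrightarrow> k \<ge> M \<Longrightarrow> dist (X m) (X k) < e"
      using metric_CauchyD[OF \<open>Cauchy X\<close> \<open>0 < e\<close>] by blast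
    have "(\<Sum>n<K. (cmod (coord (X m) n - f n))\<^sup>2) \<le> e\<^sup>2" if "m \<ge> M" for m K
    proof (rule tendsto_upperbound)
      show "(\<lambda>k. \<Sum>n<K. (cmod (coord (X m) n - coord (X k) n))\<^sup>2)
              \<longlonglongrightarrow> (\<Sum>n<K. (cmod (coord (X m) n - f n))\<^sup>2)"
        by (intro tendsto_intros f)
      show "\<forall>\<^sub>F k in sequentially. (\<Sum>n<K. (cmod (coord (X m) n - coord (X k) n))\<^sup>2) \<le> e\<^sup>2"
        using eventually_ge_at_top[of M]
      proof eventually_elim
        case (elim k)
        have "(\<Sum>n<K. (cmod (coord (X m) n - coord (X k) n))\<^sup>2) \<le> (norm (X m - X k))\<^sup>2"
          using sum_coord_le_norm[of "X m - X k" K] by simp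
        also have "\<dots> \<le> e\<^sup>2"
          using M[OF that elim] by (intro power_mono) (auto simp: dist_norm)
        finally show ?case .
      qed
    qed simp
    then show ?thesis by blast
  qed
  have ss: "square_summable (\<lambda>n. coord (X m) n - f n)"
    if "\<And>K. (\<Sum>n<K. (cmod (coord (X m) n - f n))\<^sup>2) \<le> B" for m B
    unfolding square_summable_def by (rule summableI_nonneg_bounded[OF _ that]) simp
  obtain m where "\<And>K. (\<Sum>n<K. (cmod (coord (X m) n - f n))\<^sup>2) \<le> 1\<^sup>2"
    using tail[of 1] by auto
  from square_summable_diff[OF square_summable_coord[of "X m"] ss[OF this]]
  have "square_summable f" by simp
  then obtain x where x: "coord x = f"
    using Abs_ell2_inverse by blast
  have "X \<longlonglongrightarrow> x"
  proof (rule metric_LIMSEQ_I)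
    fix r :: real assume "0 < r"
    then obtain M where M: "\<And>m K. m \<ge> M \<Longrightarrow> (\<Sum>n<K. (cmod (coord (X m) n - f n))\<^sup>2) \<le> (r/2)\<^sup>2"
      using tail[of "r/2"] by auto
    have "dist (X m) x < r" if "m \<ge> M" for m
    proof -
      have "(norm (X m - x))\<^sup>2 \<le> (r/2)\<^sup>2"
        unfolding norm_ell2_power2 using M[OF that] ss[OF M[OF that]]
        by (intro suminf_le_const) (auto simp: x square_summable_def)
      then have "norm (X m - x) \<le> r/2"
        by (rule power2_le_imp_le) (use \<open>0 < r\<close> in simp)
      then show ?thesis using \<open>0 < r\<close> by (simp add: dist_norm)
    qed
    then show "\<exists>M. \<forall>m\<ge>M. dist (X m) x < r" by blast
  qed
  then show "convergent X" by (auto simp: convergent_def)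
qed

text \<open>\<open>Vector_Spaces.linear\<close> over the field of complex numbers, i.e. complex linearity.\<close>

definition bounded_clinear :: "(ell2 \<Rightarrow> ell2) \<Rightarrow> bool" where
  "bounded_clinear T \<longleftrightarrow>
     Vector_Spaces.linear scaleC_ell2 scaleC_ell2 T \<and> (\<exists>K. \<forall>x. norm (T x) \<le> K * norm x)"


section \<open>Linear dynamics\<close>

definition return_set :: "('a \<Rightarrow> 'a) \<Rightarrow> 'a set \<Rightarrow> 'a set \<Rightarrow> nat set" where
  "return_set T U V = {n. (T ^^ n) ` U \<inter> V \<noteq> {}}"

definition mixing :: "('a::topological_space \<Rightarrow> 'a) \<Rightarrow> bool" where
  "mixing T \<longleftrightarrow>
     (\<forall>U V. open U \<and> U \<noteq> {} \<and> open V \<and> V \<noteq> {} \<longrightarrow> finite (- return_set T U V))"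

definition hypercyclic :: "('a::topological_space \<Rightarrow> 'a) \<Rightarrow> bool" where
  "hypercyclic T \<longleftrightarrow> (\<exists>x. closure {(T ^^ n) x | n. True} = UNIV)"

definition periodic_point :: "('a \<Rightarrow> 'a) \<Rightarrow> 'a \<Rightarrow> bool" where
  "periodic_point T x \<longleftrightarrow> (\<exists>k\<ge>1. (T ^^ k) x = x)"

definition chaotic :: "('a::topological_space \<Rightarrow> 'a) \<Rightarrow> bool" where
  "chaotic T \<longleftrightarrow> hypercyclic T \<and> closure {x. periodic_point T x} = UNIV"

text \<open>\<open>enumerate A\<close> lists an infinite set \<open>A\<close> of naturals in strictly increasing order.\<close>

definition syndetic :: "nat set \<Rightarrow> bool" where
  "syndetic A \<longleftrightarrow>
     infinite A \<and> (\<exists>M>0. \<forall>n. enumerate A (Suc n) - enumerate A n < M)"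

text \<open>A tuple of operators is a list; \<open>Us\<close> is the tuple of open sets belonging to it.\<close>

definition d_syndetic :: "('a::topological_space \<Rightarrow> 'a) list \<Rightarrow> bool" where
  "d_syndetic Ts \<longleftrightarrow>
     (\<forall>U\<^sub>0 Us. length Us = length Ts \<and> open U\<^sub>0 \<and> U\<^sub>0 \<noteq> {} \<and>
        (\<forall>U\<in>set Us. open U \<and> U \<noteq> {}) \<longrightarrow>
        syndetic {k. (\<Inter>i<length Ts. (Ts ! i ^^ k) -` (Us ! i)) \<inter> U\<^sub>0 \<noteq> {}})"

end

theory Submission
  imports Defs
begin

text \<open>
  Since the periodic points of a chaotic operator are dense, one return time of a triple of open
  sets produces a whole arithmetic progression of them; so \<open>(T, T\<^sup>2)\<close> fails to be
  \<open>d\<close>-syndetic only if some triple of open sets has no return time at all.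

  All finitely supported vectors are periodic for the operator \<open>T\<close> below. The basis is cut into
  cyclic blocks of length \<open>2 ^ s\<close>, every level \<open>s\<close> containing many blocks, and each block has a
  target basis vector \<open>u\<close> of lower level. Rescaled basis vectors \<open>e\<^sub>j\<close> of a block satisfy
  \<open>T ^ n e\<^sub>j = e\<^bsub>j+n\<^esub> + (\<chi>(j+n) - \<chi>(j)) T ^ (j+n) u\<close>, indices modulo the length \<open>32 R\<close>, where
  \<open>\<chi>\<close> is the indicator function of \<open>[8 R, 32 R)\<close>. The norms of the \<open>e\<^sub>j\<close> are tiny on \<open>[0, 3 R)\<close> and
  on \<open>[8 R, 11 R)\<close>, and huge outside \<open>[0, 4 R) \<union> [8 R, 12 R)\<close>. Moving from the first tiny arc to the
  second one reaches \<open>u\<close> from a tiny vector at all times in \<open>(5 R, 10 R]\<close>, which makes \<open>T\<close> mixing.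
  On the other hand, three positions \<open>j, j+n, j+2n\<close> that all avoid the huge region lie in the same arc,
  because no arithmetic progression modulo \<open>32 R\<close> meets both. Hence a vector for which \<open>x\<close>, \<open>T ^ n x\<close>
  and \<open>T ^ (2n) x\<close> are all small outside the lowest level injects almost nothing into the lower blocks,
  and \<open>T ^ (2n) x\<close> cannot be close to a fixed basis vector.
\<close>

section \<open>The sequence space\<close>

lemma coord_sum [simp]: "coord (sum f A) n = (\<Sum>i\<in>A. coord (f i) n)"
  by (induction A rule: infinite_finite_induct) auto

lemma norm_scaleC [simp]: "norm (c *\<^sub>C x) = cmod c * norm x"
proof (rule power2_eq_imp_eq)
  have "summable (\<lambda>n. (cmod (coord x n))\<^sup>2)"
    using square_summable_coord[of x] by (simp add: square_summable_def)
  then show "(norm (c *\<^sub>C x))\<^sup>2 = (cmod c * norm x)\<^sup>2"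
    by (simp add: norm_ell2_power2 norm_mult power_mult_distrib suminf_mult)
qed auto

lemma scaleR_eq_scaleC: "r *\<^sub>R x = complex_of_real r *\<^sub>C x"
  by (simp add: scaleR_ell2_def)

lemma bounded_linear_scaleC: "bounded_linear (\<lambda>x. c *\<^sub>C x)"
  by (rule bounded_linear_intro[where K = "cmod c"])
    (auto intro!: ell2_eqI simp: algebra_simps)

lemma norm_le_of_sums:
  assumes "0 \<le> B" "\<And>n. (\<Sum>i<n. (cmod (coord x i))\<^sup>2) \<le> B\<^sup>2"
  shows "norm x \<le> B"
proof (rule power2_le_imp_le)
  show "(norm x)\<^sup>2 \<le> B\<^sup>2"
    unfolding norm_ell2_power2 using assms square_summable_coord[of x]
    by (intro suminf_le_const) (auto simp: square_summable_def)
qed fact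

lift_definition basis_vec :: "nat \<Rightarrow> ell2" is "\<lambda>k n. if n = k then 1 else 0"
  unfolding square_summable_def by (rule summable_finite[of "{k}" for k]) auto

declare basis_vec.rep_eq [simp]

lemma norm_basis_vec [simp]: "norm (basis_vec k) = 1"
proof (rule power2_eq_imp_eq)
  have "(\<lambda>n. (cmod (coord (basis_vec k) n))\<^sup>2) = (\<lambda>n. if n = k then 1 else 0)"
    by auto
  then show "(norm (basis_vec k))\<^sup>2 = 1\<^sup>2"
    unfolding norm_ell2_power2 using sums_single[of k "\<lambda>_. 1 :: real"] by (simp add: sums_iff)
qed auto

section \<open>Finitely supported vectors and truncation\<close>

definition supp_below :: "nat \<Rightarrow> ell2 \<Rightarrow> bool" where
  "supp_below M x \<longleftrightarrow> (\<forall>k\<ge>M. coord x k = 0)"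

lemma supp_below_basis_vec: "k < M \<Longrightarrow> supp_below M (basis_vec k)"
  by (auto simp: supp_below_def)

lemma supp_below_add: "supp_below M x \<Longrightarrow> supp_below M y \<Longrightarrow> supp_below M (x + y)"
  and supp_below_diff: "supp_below M x \<Longrightarrow> supp_below M y \<Longrightarrow> supp_below M (x - y)"
  and supp_below_scaleC: "supp_below M x \<Longrightarrow> supp_below M (c *\<^sub>C x)"
  and supp_below_scaleR: "supp_below M x \<Longrightarrow> supp_below M (r *\<^sub>R x)"
  by (auto simp: supp_below_def)

lemma supp_below_sum: "(\<And>i. i \<in> A \<Longrightarrow> supp_below M (f i)) \<Longrightarrow> supp_below M (sum f A)"
  by (auto simp: supp_below_def)

lemma supp_below_mono: "supp_below M x \<Longrightarrow> M \<le> N \<Longrightarrow> supp_below N x"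
  by (auto simp: supp_below_def)

definition trunc :: "nat \<Rightarrow> ell2 \<Rightarrow> ell2" where
  "trunc M x = (\<Sum>k<M. coord x k *\<^sub>C basis_vec k)"

lemma coord_trunc [simp]: "coord (trunc M x) n = (if n < M then coord x n else 0)"
proof -
  have "(\<Sum>k<M. coord x k * (if n = k then 1 else 0)) = (\<Sum>k<M. if n = k then coord x k else 0)"
    by (intro sum.cong) auto
  then show ?thesis
    by (simp add: trunc_def sum.delta)
qed

lemma supp_below_trunc: "supp_below M (trunc M x)"
  by (simp add: supp_below_def)

lemma trunc_of_supp_below: "supp_below M x \<Longrightarrow> trunc M x = x"
  by (auto intro!: ell2_eqI simp: supp_below_def)

lemma norm_trunc_le: "norm (trunc M x) \<le> norm x"
proof (rule norm_le_of_sums)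
  fix n
  have "(\<Sum>i<n. (cmod (coord (trunc M x) i))\<^sup>2) \<le> (\<Sum>i<n. (cmod (coord x i))\<^sup>2)"
    by (intro sum_mono) auto
  also have "\<dots> \<le> (norm x)\<^sup>2" by (rule sum_coord_le_norm)
  finally show "(\<Sum>i<n. (cmod (coord (trunc M x) i))\<^sup>2) \<le> (norm x)\<^sup>2" .
qed simp

text \<open>The squared norm of the tail is \<open>(norm x)\<^sup>2\<close> minus a partial sum of
  the series defining it, so it tends to 0.\<close>

lemma trunc_tendsto: "(\<lambda>M. trunc M x) \<longlonglongrightarrow> x"
proof -
  define f where "f n = (cmod (coord x n))\<^sup>2" for n
  have sf: "summable f"
    using square_summable_coord[of x] by (simp add: square_summable_def f_def[abs_def])
  have "(norm (x - trunc M x))\<^sup>2 = (norm x)\<^sup>2 - (\<Sum>i<M. f i)" for M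
  proof -
    define h where "h n = (cmod (coord (x - trunc M x) n))\<^sup>2" for n
    have sh: "summable h"
      using square_summable_coord[of "x - trunc M x"] by (simp only: square_summable_def h_def[abs_def])
    have "suminf h = (\<Sum>n. h (n + M)) + (\<Sum>i<M. h i)"
      by (rule suminf_split_initial_segment[OF sh])
    moreover have "(\<Sum>i<M. h i) = 0" by (simp add: h_def)
    moreover have "(\<lambda>n. h (n + M)) = (\<lambda>n. f (n + M))" by (auto simp: h_def f_def)
    moreover have "suminf f = (\<Sum>n. f (n + M)) + (\<Sum>i<M. f i)"
      by (rule suminf_split_initial_segment[OF sf])
    ultimately have "suminf h = suminf f - (\<Sum>i<M. f i)" by simp
    then show ?thesis
      by (simp only: norm_ell2_power2 f_def[abs_def] h_def[abs_def])
  qed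
  moreover have "(\<lambda>M. (norm x)\<^sup>2 - (\<Sum>i<M. f i)) \<longlonglongrightarrow> (norm x)\<^sup>2 - suminf f"
    using summable_LIMSEQ[OF sf] by (intro tendsto_intros)
  moreover have "suminf f = (norm x)\<^sup>2"
    by (simp only: norm_ell2_power2 f_def[abs_def])
  ultimately have "(\<lambda>M. (norm (x - trunc M x))\<^sup>2) \<longlonglongrightarrow> 0"
    by simp
  then have "(\<lambda>M. sqrt ((norm (x - trunc M x))\<^sup>2)) \<longlonglongrightarrow> sqrt 0"
    by (rule tendsto_real_sqrt)
  then have "(\<lambda>M. norm (trunc M x - x)) \<longlonglongrightarrow> 0"
    by (simp add: norm_minus_commute)
  then show ?thesis
    by (simp add: LIM_zero_iff tendsto_norm_zero_iff)
qed

text \<open>Density of finitely supported vectors. It reduces periodicity, mixing and the failure of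
  return times to computations inside finitely many blocks.\<close>

lemma open_contains_supp_below:
  assumes "open U" "x \<in> U"
  obtains M y where "supp_below M y" "y \<in> U"
proof -
  have "\<forall>\<^sub>F M in sequentially. trunc M x \<in> U"
    using trunc_tendsto assms by (rule topological_tendstoD)
  then obtain M where "trunc M x \<in> U"
    using eventually_happens'[OF sequentially_bot] by blast
  then show ?thesis using that supp_below_trunc by blast
qed

lemma closure_eq_UNIV_iff:
  "closure S = UNIV \<longleftrightarrow> (\<forall>U. open U \<and> U \<noteq> {} \<longrightarrow> S \<inter> U \<noteq> {})"
proof
  assume *: "closure S = UNIV"
  show "\<forall>U. open U \<and> U \<noteq> {} \<longrightarrow> S \<inter> U \<noteq> {}"
    using open_Int_closure_eq_empty[of _ S] * by (auto simp: Int_commute)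
next
  assume *: "\<forall>U. open U \<and> U \<noteq> {} \<longrightarrow> S \<inter> U \<noteq> {}"
  have "- closure S = {}"
    using * closure_subset[of S] by (metis disjoint_iff open_Compl closed_closure subsetD ComplD)
  then show "closure S = UNIV" by blast
qed

section \<open>Separability and the Birkhoff transitivity theorem\<close>

lemma countable_dense_ell2:
  obtains D :: "ell2 set" where "countable D" "closure D = UNIV"
proof
  define v :: "(rat \<times> rat) list \<Rightarrow> ell2" where
    "v xs = (\<Sum>k<length xs. Complex (of_rat (fst (xs ! k))) (of_rat (snd (xs ! k))) *\<^sub>C basis_vec k)" for xs
  show "countable (range v)" by simp
  have "\<exists>xs. v xs \<in> U" if U: "open U" "x \<in> U" for U x
  proof -
    obtain M y where y: "supp_below M y" "y \<in> U"
      using open_contains_supp_below[OF U] by blast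
    obtain e where e: "e > 0" "ball y e \<subseteq> U"
      using U(1) y(2) openE by blast
    \<comment> \<open>Error budget per coordinate: \<open>M\<close> of them add up to less than
      \<open>e\<close>, and the added 1 covers the case \<open>M = 0\<close>.\<close>
    define d where "d = e / (real M + 1)"
    have d: "d > 0" using e by (simp add: d_def)
    have "\<exists>p. cmod (Complex (of_rat (fst p)) (of_rat (snd p)) - c) < d" for c
    proof -
      have approx: "\<exists>q. \<bar>of_rat q - r\<bar> < d / 2" for r :: real
      proof -
        obtain q where "r - d / 2 < of_rat q" "of_rat q < r + d / 2"
          using of_rat_dense[of "r - d / 2" "r + d / 2"] d by auto
        then show ?thesis by (intro exI[of _ q]) linarith
      qed
      obtain a where a: "\<bar>of_rat a - Re c\<bar> < d / 2" using approx by blast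
      obtain b where b: "\<bar>of_rat b - Im c\<bar> < d / 2" using approx by blast
      have "cmod (Complex (of_rat a) (of_rat b) - c) \<le> \<bar>of_rat a - Re c\<bar> + \<bar>of_rat b - Im c\<bar>"
        using cmod_le[of "Complex (of_rat a) (of_rat b) - c"] by simp
      then show ?thesis using a b by (intro exI[of _ "(a, b)"]) simp
    qed
    then obtain p where p: "\<And>c. cmod (Complex (of_rat (fst (p c))) (of_rat (snd (p c))) - c) < d"
      by metis
    define xs where "xs = map (\<lambda>k. p (coord y k)) [0..<M]"
    have "v xs - y = v xs - trunc M y"
      using y(1) by (simp add: trunc_of_supp_below)
    also have "\<dots> = (\<Sum>k<M. (Complex (of_rat (fst (p (coord y k)))) (of_rat (snd (p (coord y k)))) - coord y k) *\<^sub>C basis_vec k)"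
      unfolding v_def trunc_def
      by (auto intro!: ell2_eqI simp: xs_def sum_subtractf[symmetric] algebra_simps intro!: sum.cong)
    finally have "norm (v xs - y) \<le> (\<Sum>k<M. d)"
      by (simp only:) (rule sum_norm_le, simp add: less_imp_le[OF p])
    also have "\<dots> < e" using e by (simp add: d_def field_simps)
    finally have "v xs \<in> ball y e" by (simp add: dist_norm norm_minus_commute)
    then show ?thesis using e by blast
  qed
  then show "closure (range v) = UNIV"
    unfolding closure_eq_UNIV_iff by blast
qed


text \<open>Birkhoff's argument: the points whose orbit enters a given ball form an open dense set,
  and by Baire countably many such sets have a common point. Balls with centres in a countable dense
  set are enough to make its orbit dense.\<close>

lemma mixing_imp_hypercyclic:
  fixes T :: "ell2 \<Rightarrow> ell2"
  assumes T: "mixing T" "continuous_on UNIV T"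
  shows "hypercyclic T"
proof -
  have cont: "continuous_on UNIV (T ^^ n)" for n
  proof (induction n)
    case (Suc n)
    then show ?case
      using continuous_on_compose2[OF T(2) Suc] by (simp add: o_def)
  qed (simp add: id_def)
  obtain D :: "ell2 set" where D: "countable D" "closure D = UNIV"
    by (rule countable_dense_ell2)
  \<comment> \<open>The second component fixes the radius; only centres in \<open>D\<close> enter
    the intersection, which keeps the family countable.\<close>
  define B where "B p = ball (fst p) (1 / real (Suc (snd p)))" for p :: "ell2 \<times> nat"
  define G where "G p = (\<Union>n. (T ^^ n) -` B p)" for p
  have opG: "open (G p)" for p
    unfolding G_def B_def using cont by (intro open_UN ballI open_vimage) auto
  have "G p \<inter> U \<noteq> {}" if U: "open U" "U \<noteq> {}" for p U
  proof -
    have "open (B p)" "B p \<noteq> {}" by (auto simp: B_def)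
    then have "finite (- return_set T U (B p))"
      using T(1) U unfolding mixing_def by blast
    then have "return_set T U (B p) \<noteq> {}"
      by (metis Compl_empty_eq infinite_UNIV_nat)
    then show ?thesis by (auto simp: return_set_def G_def)
  qed
  then have clG: "closure (G p) = UNIV" for p
    unfolding closure_eq_UNIV_iff by blast
  have "euclidean closure_of \<Inter>(G ` (D \<times> UNIV)) = topspace (euclidean :: ell2 topology)"
  proof (rule Baire_category)
    have "complete (UNIV :: ell2 set)" by (rule complete_UNIV)
    then show "completely_metrizable_space (euclidean :: ell2 topology) \<or>
        locally_compact_space (euclidean :: ell2 topology) \<and> regular_space (euclidean :: ell2 topology)"
      by (simp add: completely_metrizable_space_euclidean)
  qed (use D opG clG in auto)
  then have "\<Inter>(G ` (D \<times> UNIV)) \<noteq> {}"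
    by auto
  then obtain x where x: "\<And>d m. d \<in> D \<Longrightarrow> x \<in> G (d, m)"
    by blast
  have "{(T ^^ n) x | n. True} \<inter> U \<noteq> {}" if U: "open U" "U \<noteq> {}" for U
  proof -
    obtain d where d: "d \<in> D" "d \<in> U"
      using D(2) U unfolding closure_eq_UNIV_iff by blast
    then obtain e where e: "e > 0" "ball d e \<subseteq> U"
      using U(1) openE by blast
    then obtain m where m: "1 / real (Suc m) < e"
      using nat_approx_posE by blast
    obtain n where "(T ^^ n) x \<in> ball d (1 / real (Suc m))"
      using x[OF d(1), of m] by (auto simp: G_def B_def)
    then have "(T ^^ n) x \<in> U"
      using m e(2) by (auto simp: subset_iff)
    then show ?thesis by blast
  qed
  then show ?thesis
    unfolding hypercyclic_def closure_eq_UNIV_iff by blast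
qed

section \<open>Blocks, weights and targets\<close>

text \<open>Indices below \<open>4 ^ 12\<close> are fixed by the operator. For \<open>s > 12\<close>, level \<open>s\<close> consists of the indices in
  \<open>[4 ^ (s - 1), 4 ^ s)\<close>, cut into consecutive blocks of length \<open>2 ^ s\<close>; the blocks, numbered from
  \<open>2 ^ (s - 2)\<close> on, have the targets \<open>0, 1, 2, \<dots>\<close>. The bound \<open>12\<close> makes \<open>5 * s + 1 \<le> 2 ^ (s - 6)\<close> at
  all levels.\<close>

definition lev :: "nat \<Rightarrow> nat" where
  "lev k = (LEAST s. 12 \<le> s \<and> k < 4 ^ s)"

lemma lev_prop: "12 \<le> lev k" "k < 4 ^ lev k"
proof -
  have "k < 4 ^ k" by (induction k) auto
  also have "(4::nat) ^ k \<le> 4 ^ max 12 k" by (rule power_increasing) auto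
  finally have "12 \<le> max 12 k \<and> k < 4 ^ max 12 k" by simp
  then have "12 \<le> lev k \<and> k < 4 ^ lev k"
    unfolding lev_def by (rule LeastI)
  then show "12 \<le> lev k" "k < 4 ^ lev k" by auto
qed

lemma lev_le: "12 \<le> s \<Longrightarrow> k < 4 ^ s \<Longrightarrow> lev k \<le> s"
  unfolding lev_def by (rule Least_le) simp

lemma lev_eqI:
  assumes "12 < s" "4 ^ (s - 1) \<le> k" "k < 4 ^ s"
  shows "lev k = s"
proof (rule antisym)
  show "lev k \<le> s" using assms by (intro lev_le) auto
  show "s \<le> lev k"
  proof (rule ccontr)
    assume "\<not> s \<le> lev k"
    then have "(4::nat) ^ lev k \<le> 4 ^ (s - 1)" by (intro power_increasing) auto
    then show False using lev_prop(2)[of k] assms(2) by linarith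
  qed
qed

lemma lev_lower: "4 ^ 12 \<le> k \<Longrightarrow> 12 < lev k \<and> 4 ^ (lev k - 1) \<le> k"
proof -
  assume k: "4 ^ 12 \<le> k"
  have "lev k \<noteq> 12" using lev_prop(2)[of k] k by (metis leD)
  then have 1: "12 < lev k" using lev_prop(1)[of k] by linarith
  have "4 ^ (lev k - 1) \<le> k"
  proof (rule ccontr)
    assume "\<not> 4 ^ (lev k - 1) \<le> k"
    then have "lev k \<le> lev k - 1" using 1 by (intro lev_le) auto
    then show False using 1 by simp
  qed
  with 1 show ?thesis by simp
qed

definition pos :: "nat \<Rightarrow> nat" where
  "pos k = k mod 2 ^ lev k"

definition shift :: "nat \<Rightarrow> nat" where
  "shift k = (if k < 4 ^ 12 then k else k - pos k + (pos k + 1) mod 2 ^ lev k)"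

definition target :: "nat \<Rightarrow> nat" where
  "target k = k div 2 ^ lev k - 2 ^ (lev k - 2)"

text \<open>The indicator function chi of the overview: \<open>2 ^ (lev k - 2)\<close> is
  \<open>8 R\<close> for \<open>R = 2 ^ (lev k - 5)\<close>.\<close>

definition phase :: "nat \<Rightarrow> real" where
  "phase k = (if 2 ^ (lev k - 2) \<le> pos k then 1 else 0)"

text \<open>Doubling climbs from 1 to this value in \<open>R = 2 ^ (s - 5)\<close> steps, the length
  of one ramp in \<open>profile\<close>. Being doubly exponential, each height is the square of the
  one a level below.\<close>

definition height :: "nat \<Rightarrow> real" where
  "height s = 2 ^ 2 ^ (s - 5)"

text \<open>Truncated subtraction keeps the exponent at 0 on the first \<open>3 R\<close> positions
  of each arc; then it rises by one per step and reaches \<open>R\<close> at the last position,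
  where it joins \<open>height s\<close>. Descents may be abrupt, because boundedness only limits
  growth.\<close>

definition profile :: "nat \<Rightarrow> nat \<Rightarrow> real" where
  "profile s j = (let R = 2 ^ (s - 5) in
     if j < 4 * R then 2 ^ (j + 1 - 3 * R)
     else if 8 * R \<le> j \<and> j < 12 * R then 2 ^ (j + 1 - 11 * R)
     else height s) / 2 ^ s"

definition weight :: "nat \<Rightarrow> real" where
  "weight k = (if k < 4 ^ 12 then 1 else profile (lev k) (pos k))"

lemma two_power_split: "5 \<le> s \<Longrightarrow> (2::nat) ^ s = 32 * 2 ^ (s - 5)" "5 \<le> s \<Longrightarrow> (2::nat) ^ (s - 2) = 8 * 2 ^ (s - 5)"
proof -
  assume "5 \<le> s"
  then obtain r where "s = r + 5" by (metis le_Suc_ex add.commute)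
  then show "(2::nat) ^ s = 32 * 2 ^ (s - 5)" "(2::nat) ^ (s - 2) = 8 * 2 ^ (s - 5)"
    by (simp_all add: power_add numeral_eq_Suc)
qed

section \<open>Arithmetic of the cyclic blocks\<close>

lemma block_index:
  assumes s: "12 < s" and a: "2 ^ s dvd a" "4 ^ (s - 1) \<le> a" "a < 4 ^ s" and j: "j < 2 ^ s"
  shows "lev (a + j) = s" "pos (a + j) = j" "4 ^ 12 \<le> a" "4 ^ (s - 1) \<le> a + j" "a + j < 4 ^ s"
proof -
  obtain c where c: "a = 2 ^ s * c" using a(1) by blast
  have e: "(4::nat) ^ s = 2 ^ s * 2 ^ s"
    by (simp flip: power_mult_distrib)
  have "c < 2 ^ s" using a(3) c e by simp
  \<comment> \<open>The multiple of \<open>2 ^ s\<close> following \<open>a\<close> is at most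
    \<open>4 ^ s\<close>, so the block does not leave its level.\<close>
  then have "2 ^ s * (c + 1) \<le> 2 ^ s * (2::nat) ^ s"
    by (intro mult_le_mono2) simp
  then show u: "a + j < 4 ^ s" using c e j by simp
  show l: "4 ^ (s - 1) \<le> a + j" using a(2) by simp
  show "lev (a + j) = s" using s l u by (rule lev_eqI)
  then show "pos (a + j) = j" using c j by (simp add: pos_def)
  have "(4::nat) ^ 12 \<le> 4 ^ (s - 1)" using s by (intro power_increasing) auto
  then show "4 ^ 12 \<le> a" using a(2) by linarith
qed

text \<open>The level starts at \<open>4 ^ (lev k - 1)\<close>, a multiple of the block length
  \<open>2 ^ lev k\<close>, so rounding \<open>k\<close> down to a multiple of that length stays
  within the level.\<close>

lemma block_decomp:
  assumes "4 ^ 12 \<le> k"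
  obtains a where "k = a + pos k" "2 ^ lev k dvd a" "4 ^ (lev k - 1) \<le> a" "a < 4 ^ lev k" "pos k < 2 ^ lev k" "12 < lev k"
proof
  let ?a = "2 ^ lev k * (k div 2 ^ lev k)"
  show "k = ?a + pos k" by (simp add: pos_def)
  show "2 ^ lev k dvd ?a" by simp
  show "?a < 4 ^ lev k" using lev_prop(2)[of k] \<open>k = ?a + pos k\<close> by linarith
  show "pos k < 2 ^ lev k" by (simp add: pos_def)
  show l: "12 < lev k" using lev_lower[OF assms] by simp
  have "lev k \<le> 2 * (lev k - 1)" using l by linarith
  then have "(2::nat) ^ lev k dvd 2 ^ (2 * (lev k - 1))" by (rule le_imp_power_dvd)
  then have "(2::nat) ^ lev k dvd 4 ^ (lev k - 1)" by (simp add: power_mult)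
  then obtain d where d: "(4::nat) ^ (lev k - 1) = 2 ^ lev k * d" by blast
  have "2 ^ lev k * d \<le> k" using lev_lower[OF assms] d by simp
  then have "d \<le> k div 2 ^ lev k"
    by (simp add: less_eq_div_iff_mult_less_eq mult.commute)
  then show "4 ^ (lev k - 1) \<le> ?a" unfolding d by simp
qed

lemma shift_block:
  assumes s: "12 < s" and a: "2 ^ s dvd a" "4 ^ (s - 1) \<le> a" "a < 4 ^ s" and j: "j < 2 ^ s"
  shows "(shift ^^ n) (a + j) = a + (j + n) mod 2 ^ s"
proof (induction n)
  case (Suc n)
  have *: "(j + n) mod 2 ^ s < 2 ^ s" by simp
  note b = block_index[OF s a *]
  have "(shift ^^ Suc n) (a + j) = shift (a + (j + n) mod 2 ^ s)"
    using Suc by simp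
  also have "\<dots> = a + ((j + n) mod 2 ^ s + 1) mod 2 ^ s"
    using b by (simp add: shift_def)
  also have "\<dots> = a + (j + Suc n) mod 2 ^ s"
    by (simp add: mod_Suc_eq)
  finally show ?case .
qed (use j in simp)

lemma shift_base: "k < 4 ^ 12 \<Longrightarrow> (shift ^^ n) k = k"
  by (induction n) (auto simp: shift_def)

text \<open>\<open>shift\<close> preserves levels and its power \<open>2 ^ lev k\<close> fixes
  \<open>k\<close>, so one power less inverts it at \<open>k\<close>.\<close>

lemma bij_shift: "bij shift"
proof (rule bijI)
  have cyc: "(shift ^^ 2 ^ lev k) k = k" for k
  proof (cases "k < 4 ^ 12")
    case False
    then obtain a where a: "k = a + pos k" "2 ^ lev k dvd a" "4 ^ (lev k - 1) \<le> a"
      "a < 4 ^ lev k" "pos k < 2 ^ lev k" "12 < lev k"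
      using block_decomp[of k] by auto
    have "(shift ^^ 2 ^ lev k) (a + pos k) = a + pos k"
      using shift_block[OF a(6,2-5)] a(5) by simp
    then show ?thesis using a(1) by simp
  qed (rule shift_base)
  have lev_shift: "lev (shift k) = lev k" for k
  proof (cases "k < 4 ^ 12")
    case False
    then obtain a where a: "k = a + pos k" "2 ^ lev k dvd a" "4 ^ (lev k - 1) \<le> a"
      "a < 4 ^ lev k" "pos k < 2 ^ lev k" "12 < lev k"
      using block_decomp[of k] by auto
    have "shift k = a + (pos k + 1) mod 2 ^ lev k"
      using shift_block[OF a(6,2-5), of 1] a(1) by simp
    then show ?thesis using block_index(1)[OF a(6,2-4)] by simp
  qed (simp add: shift_def)
  have eq: "(shift ^^ (2 ^ lev k - 1)) (shift k) = k" "shift ((shift ^^ (2 ^ lev k - 1)) k) = k" for k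
  proof -
    have "Suc (2 ^ lev k - 1) = 2 ^ lev k" by simp
    then show "(shift ^^ (2 ^ lev k - 1)) (shift k) = k" "shift ((shift ^^ (2 ^ lev k - 1)) k) = k"
      using cyc[of k] by (metis funpow_Suc_right comp_apply, metis funpow.simps(2) comp_apply)
  qed
  show "inj shift"
    by (rule injI) (metis eq(1) lev_shift)
  show "surj shift"
    by (rule surjI) (rule eq(2))
qed

section \<open>Growth of the heights and shape of the weights\<close>

lemma five_lev: "13 \<le> s \<Longrightarrow> 5 * s + 1 \<le> (2::nat) ^ (s - 6)"
proof (induction s rule: dec_induct)
  case (step n)
  then have "Suc n - 6 = Suc (n - 6)" by linarith
  then have "(2::nat) ^ (Suc n - 6) = 2 * 2 ^ (n - 6)" by (simp only: power_Suc)
  moreover have "5 * Suc n + 1 \<le> 2 * (5 * n + 1)" using step by simp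
  ultimately show ?case using step(3) by (metis le_trans mult_le_mono2)
qed simp

lemma height_square: "13 \<le> s \<Longrightarrow> height s = (height (s - 1))\<^sup>2"
proof -
  assume "13 \<le> s"
  then have "s - 5 = Suc (s - 1 - 5)" by simp
  then show ?thesis unfolding height_def by (simp add: power_mult[symmetric] mult.commute)
qed

text \<open>This growth pays for the \<open>4 ^ s\<close> indices of a level and the factors
  \<open>2 ^ s\<close> from the weights: it makes the jumps summable, bounds the orbits and makes
  the injection in \<open>no_double_return\<close> small.\<close>

lemma height_lower: "13 \<le> s \<Longrightarrow> 2 ^ (5 * s + 1) \<le> height (s - 1)"
  using five_lev[of s] unfolding height_def by (intro power_increasing) auto

lemma height_ge_1: "1 \<le> height s"
  by (simp add: height_def)

lemma profile_bounds:
  "1 / 2 ^ s \<le> profile s j" "profile s j \<le> height s / 2 ^ s"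
proof -
  \<comment> \<open>Covers both ramps at once: \<open>c = 3\<close> and \<open>c = 11\<close> are
    where they begin, and the exponent never exceeds \<open>R\<close>.\<close>
  have "(2::real) ^ (j + 1 - c * 2 ^ (s - 5)) \<le> height s" if "j < (c + 1) * 2 ^ (s - 5)" for c
    using that unfolding height_def by (intro power_increasing) auto
  from this[of 3] this[of 11] show "1 / 2 ^ s \<le> profile s j" "profile s j \<le> height s / 2 ^ s"
    by (auto simp: profile_def Let_def divide_right_mono height_ge_1)
qed

lemma profile_double:
  assumes "12 < s" "j < 2 ^ s"
  shows "profile s ((j + 1) mod 2 ^ s) \<le> 2 * profile s j"
proof -
  define R :: nat where "R = 2 ^ (s - 5)"
  have L: "2 ^ s = 32 * R" using assms(1) two_power_split[of s] by (simp add: R_def)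
  have R: "R > 0" by (simp add: R_def)
  have mono: "2 ^ (j + 1 + 1 - c) \<le> 2 * (2::real) ^ (j + 1 - c)" for c
  proof -
    have "(2::real) ^ (j + 1 + 1 - c) \<le> 2 ^ Suc (j + 1 - c)"
      by (intro power_increasing) auto
    then show ?thesis by simp
  qed
  have h: "height s = 2 ^ R" by (simp add: height_def R_def)
  define p where "p i = 2 ^ s * profile s i" for i
  have p: "i < 4 * R \<Longrightarrow> p i = 2 ^ (i + 1 - 3 * R)" "4 * R \<le> i \<Longrightarrow> i < 8 * R \<Longrightarrow> p i = 2 ^ R"
    "8 * R \<le> i \<Longrightarrow> i < 12 * R \<Longrightarrow> p i = 2 ^ (i + 1 - 11 * R)" "12 * R \<le> i \<Longrightarrow> p i = 2 ^ R" for i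
    by (simp_all add: p_def profile_def Let_def h flip: R_def)
  have "(1::real) \<le> 2 ^ R" by (rule one_le_power) simp
  then have one: "2 ^ 0 \<le> 2 * (2::real) ^ R" unfolding power_0 by linarith
  \<comment> \<open>The interiors of the four pieces of \<open>profile\<close> and the crossings
    between them; the last case is the wrap from \<open>32 R - 1\<close> to 0.\<close>
  consider "j + 1 < 4 * R" | "j + 1 = 4 * R" | "4 * R \<le> j" "j + 1 < 8 * R" | "j + 1 = 8 * R"
    | "8 * R \<le> j" "j + 1 < 12 * R" | "j + 1 = 12 * R" | "12 * R \<le> j" "j + 1 < 32 * R" | "j + 1 = 32 * R"
    using assms(2) L by linarith
  then have "p ((j + 1) mod 2 ^ s) \<le> 2 * p j"
  proof cases
    case 1
    then have m: "(j + 1) mod 2 ^ s = j + 1" using L R by simp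
    have a: "p j = 2 ^ (j + 1 - 3 * R)" by (rule p(1)) (use 1 R in linarith)+
    have b: "p (j + 1) = 2 ^ (j + 1 + 1 - 3 * R)" by (rule p(1)) (use 1 R in linarith)+
    show ?thesis unfolding m a b by (rule mono)
  next
    case 2
    then have m: "(j + 1) mod 2 ^ s = j + 1" using L R by simp
    have a: "p j = 2 ^ (j + 1 - 3 * R)" by (rule p(1)) (use 2 R in linarith)+
    have b: "p (j + 1) = 2 ^ R" by (rule p(2)) (use 2 R in linarith)+
    have d: "j + 1 - 3 * R = R" using 2 by linarith
    show ?thesis unfolding m a b d by simp
  next
    case 3
    then have m: "(j + 1) mod 2 ^ s = j + 1" using L R by simp
    have a: "p j = 2 ^ R" by (rule p(2)) (use 3 R in linarith)+
    have b: "p (j + 1) = 2 ^ R" by (rule p(2)) (use 3 R in linarith)+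
    show ?thesis unfolding m a b by simp
  next
    case 4
    then have m: "(j + 1) mod 2 ^ s = j + 1" using L R by simp
    have a: "p j = 2 ^ R" by (rule p(2)) (use 4 R in linarith)+
    have b: "p (j + 1) = 2 ^ (j + 1 + 1 - 11 * R)" by (rule p(3)) (use 4 R in linarith)+
    have d: "j + 1 + 1 - 11 * R = 0" using 4 R by linarith
    show ?thesis unfolding m a b d by (rule one)
  next
    case 5
    then have m: "(j + 1) mod 2 ^ s = j + 1" using L R by simp
    have a: "p j = 2 ^ (j + 1 - 11 * R)" by (rule p(3)) (use 5 R in linarith)+
    have b: "p (j + 1) = 2 ^ (j + 1 + 1 - 11 * R)" by (rule p(3)) (use 5 R in linarith)+
    show ?thesis unfolding m a b by (rule mono)
  next
    case 6
    then have m: "(j + 1) mod 2 ^ s = j + 1" using L R by simp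
    have a: "p j = 2 ^ (j + 1 - 11 * R)" by (rule p(3)) (use 6 R in linarith)+
    have b: "p (j + 1) = 2 ^ R" by (rule p(4)) (use 6 R in linarith)+
    have d: "j + 1 - 11 * R = R" using 6 by linarith
    show ?thesis unfolding m a b d by simp
  next
    case 7
    then have m: "(j + 1) mod 2 ^ s = j + 1" using L R by simp
    have a: "p j = 2 ^ R" by (rule p(4)) (use 7 R in linarith)+
    have b: "p (j + 1) = 2 ^ R" by (rule p(4)) (use 7 R in linarith)+
    show ?thesis unfolding m a b by simp
  next
    case 8
    then have m: "(j + 1) mod 2 ^ s = 0" using L R by simp
    have a: "p j = 2 ^ R" by (rule p(4)) (use 8 R in linarith)+
    have b: "p (0) = 2 ^ (0 + 1 - 3 * R)" by (rule p(1)) (use 8 R in linarith)+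
    have d: "0 + 1 - 3 * R = 0" using R by linarith
    show ?thesis unfolding m a b d by (rule one)
  qed
  then show ?thesis by (simp add: p_def)
qed

text \<open>Positions below the maximal weight lie in \<open>[0, 12 R)\<close>, where \<open>2 ^ s = 32 R\<close>. Hence three of
  them in progression modulo \<open>2 ^ s\<close> satisfy \<open>j1 + j3 = 2 * j2\<close> in the integers, which is
  impossible if they do not lie in the same arc.\<close>

lemma cheap_progression:
  assumes s: "12 < s" and j: "j < 2 ^ s"
    and cheap: "profile s j < height s / 2 ^ s"
      "profile s ((j + n) mod 2 ^ s) < height s / 2 ^ s"
      "profile s ((j + 2 * n) mod 2 ^ s) < height s / 2 ^ s"
  shows "2 ^ (s - 2) \<le> (j + n) mod 2 ^ s \<longleftrightarrow> (2::nat) ^ (s - 2) \<le> j"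
    and "2 ^ (s - 2) \<le> (j + 2 * n) mod 2 ^ s \<longleftrightarrow> (2::nat) ^ (s - 2) \<le> j"
proof -
  define R :: nat where "R = 2 ^ (s - 5)"
  have L: "2 ^ s = 32 * R" and Q: "2 ^ (s - 2) = 8 * R"
    using s two_power_split[of s] by (simp_all add: R_def)
  have cheapD: "i < 4 * R \<or> 8 * R \<le> i \<and> i < 12 * R" if "profile s i < height s / 2 ^ s" for i
    using that by (auto simp: profile_def Let_def R_def split: if_splits)
  define j2 j3 where "j2 = (j + n) mod 2 ^ s" and "j3 = (j + 2 * n) mod 2 ^ s"
  have "(j + j3) mod 2 ^ s = (j + (j + 2 * n)) mod 2 ^ s"
    unfolding j3_def by (rule mod_add_right_eq)
  also have "\<dots> = (2 * (j + n)) mod 2 ^ s"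
    by (simp add: algebra_simps)
  also have "\<dots> = (2 * j2) mod 2 ^ s"
    unfolding j2_def by (rule mod_mult_right_eq[symmetric])
  finally have "(j + j3) mod 2 ^ s = (2 * j2) mod 2 ^ s" .
  moreover have "j + j3 < 32 * R" "2 * j2 < 32 * R"
    using cheapD[OF cheap(1)] cheapD[OF cheap(2)] cheapD[OF cheap(3)] unfolding j2_def j3_def by linarith+
  ultimately have "j + j3 = 2 * j2"
    unfolding L by simp
  then show "2 ^ (s - 2) \<le> (j + n) mod 2 ^ s \<longleftrightarrow> (2::nat) ^ (s - 2) \<le> j"
    and "2 ^ (s - 2) \<le> (j + 2 * n) mod 2 ^ s \<longleftrightarrow> (2::nat) ^ (s - 2) \<le> j"
    using cheapD[OF cheap(1)] cheapD[OF cheap(2)] cheapD[OF cheap(3)]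
    unfolding Q j2_def[symmetric] j3_def[symmetric] by linarith+
qed

lemma weight_pos: "0 < weight k"
  using profile_bounds(1)[of "lev k" "pos k"] unfolding weight_def
  by (auto intro: less_le_trans[rotated])

lemma weight_shift: "weight (shift k) \<le> 2 * weight k"
proof (cases "k < 4 ^ 12")
  case False
  then obtain a where a: "k = a + pos k" "2 ^ lev k dvd a" "4 ^ (lev k - 1) \<le> a"
    "a < 4 ^ lev k" "pos k < 2 ^ lev k" "12 < lev k"
    using block_decomp[of k] by auto
  have "shift k = a + (pos k + 1) mod 2 ^ lev k"
    using shift_block[OF a(6,2-5), of 1] a(1) by simp
  moreover have "(pos k + 1) mod 2 ^ lev k < 2 ^ lev k" by simp
  note b = block_index[OF a(6,2-4) this]
  ultimately have "weight (shift k) = profile (lev k) ((pos k + 1) mod 2 ^ lev k)"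
    using b(1-3) by (simp add: weight_def)
  then show ?thesis
    using profile_double[OF a(6,5)] False by (simp add: weight_def)
qed (simp add: shift_def weight_def)

text \<open>A level has fewer than \<open>2 ^ s\<close> targets, and
  \<open>2 ^ s \<le> 4 ^ (s - 2)\<close>. Dropping two levels matters: the target then has period
  \<open>2 ^ (s - 2)\<close>, which divides both positions at which the phase jumps.\<close>

lemma target_less: "4 ^ 12 \<le> k \<Longrightarrow> target k < 4 ^ (lev k - 2)"
proof -
  assume k: "4 ^ 12 \<le> k"
  have "k < 2 ^ lev k * 2 ^ lev k"
    using lev_prop(2)[of k] by (simp flip: power_mult_distrib)
  then have "k div 2 ^ lev k < 2 ^ lev k"
    by (simp add: div_less_iff_less_mult)
  then have "target k < 2 ^ lev k" unfolding target_def by linarith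
  also have "(2::nat) ^ lev k \<le> 2 ^ (2 * (lev k - 2))"
    using lev_prop(1)[of k] by (intro power_increasing) linarith+
  also have "\<dots> = 4 ^ (lev k - 2)" by (simp add: power_mult)
  finally show ?thesis .
qed

text \<open>The phase changes only on the steps from \<open>8 R - 1\<close> to \<open>8 R\<close>
  and from \<open>32 R - 1\<close> to 0. Both start at maximal weight, which makes the injected
  coefficient small, and both arrive at a multiple of \<open>8 R\<close>.\<close>

lemma phase_jump:
  assumes "phase (shift k) \<noteq> phase k"
  shows "4 ^ 12 \<le> k" "weight k = height (lev k) / 2 ^ lev k" "2 ^ (lev k - 2) dvd pos k + 1"
proof -
  show ge: "4 ^ 12 \<le> k" using assms by (auto simp: shift_def not_less[symmetric])
  then obtain a where a: "k = a + pos k" "2 ^ lev k dvd a" "4 ^ (lev k - 1) \<le> a"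
    "a < 4 ^ lev k" "pos k < 2 ^ lev k" "12 < lev k"
    using block_decomp[of k] by auto
  define R :: nat where "R = 2 ^ (lev k - 5)"
  have L: "2 ^ lev k = 32 * R" and Q: "2 ^ (lev k - 2) = 8 * R"
    using a(6) two_power_split[of "lev k"] by (simp_all add: R_def)
  have R: "R > 0" by (simp add: R_def)
  have "shift k = a + (pos k + 1) mod 2 ^ lev k"
    using shift_block[OF a(6,2-5), of 1] a(1) by simp
  moreover have "(pos k + 1) mod 2 ^ lev k < 2 ^ lev k" by simp
  note b = block_index[OF a(6,2-4) this]
  ultimately have "phase (shift k) = (if 8 * R \<le> (pos k + 1) mod (32 * R) then 1 else 0)"
    using b(1,2) by (simp add: phase_def Q flip: L)
  moreover have "phase k = (if 8 * R \<le> pos k then 1 else 0)"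
    by (simp add: phase_def Q)
  moreover have "(pos k + 1) mod (32 * R) = (if pos k + 1 = 32 * R then 0 else pos k + 1)"
    using a(5) L by auto
  ultimately have p: "pos k + 1 = 8 * R \<or> pos k + 1 = 32 * R"
    using assms by (auto split: if_splits)
  then show "2 ^ (lev k - 2) dvd pos k + 1"
    unfolding Q by (auto simp: dvd_def intro: exI[of _ "4::nat"])
  show "weight k = height (lev k) / 2 ^ lev k"
    using p ge R unfolding weight_def profile_def Let_def R_def[symmetric] by auto
qed

lemma lev_shift_pow: "lev ((shift ^^ n) k) = lev k"
  and pos_shift_pow: "4 ^ 12 \<le> k \<Longrightarrow> pos ((shift ^^ n) k) = (pos k + n) mod 2 ^ lev k"
  and target_shift_pow: "target ((shift ^^ n) k) = target k"
  and shift_pow_ge: "4 ^ 12 \<le> k \<Longrightarrow> 4 ^ (lev k - 1) \<le> (shift ^^ n) k"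
proof -
  have "lev ((shift ^^ n) k) = lev k \<and> pos ((shift ^^ n) k) = (pos k + n) mod 2 ^ lev k \<and>
    target ((shift ^^ n) k) = target k \<and> 4 ^ (lev k - 1) \<le> (shift ^^ n) k" if k: "4 ^ 12 \<le> k"
  proof -
    obtain a where a: "k = a + pos k" "2 ^ lev k dvd a" "4 ^ (lev k - 1) \<le> a"
      "a < 4 ^ lev k" "pos k < 2 ^ lev k" "12 < lev k"
      using block_decomp[OF k] by auto
    define j where "j = (pos k + n) mod 2 ^ lev k"
    have j: "j < 2 ^ lev k" by (simp add: j_def)
    have eq: "(shift ^^ n) k = a + j"
      using shift_block[OF a(6,2-5), of n] a(1) by (simp add: j_def)
    note b = block_index[OF a(6,2-4) j]
    have "(a + j) div 2 ^ lev k = k div 2 ^ lev k"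
    proof -
      have "k div 2 ^ lev k = (a + pos k) div 2 ^ lev k"
        by (rule arg_cong[OF a(1)])
      then show ?thesis using j a(2,5) by (simp add: div_plus_div_distrib_dvd_left)
    qed
    then have "target (a + j) = target k"
      by (simp only: target_def b(1))
    then show ?thesis using b eq by (simp add: j_def)
  qed
  moreover have "(shift ^^ n) k = k" if "\<not> 4 ^ 12 \<le> k"
    using that by (intro shift_base) simp
  ultimately show "lev ((shift ^^ n) k) = lev k" "target ((shift ^^ n) k) = target k"
    "4 ^ 12 \<le> k \<Longrightarrow> pos ((shift ^^ n) k) = (pos k + n) mod 2 ^ lev k"
    "4 ^ 12 \<le> k \<Longrightarrow> 4 ^ (lev k - 1) \<le> (shift ^^ n) k"
    by (cases "4 ^ 12 \<le> k"; simp)+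
qed

lemma shift_pow_less: "12 \<le> s \<Longrightarrow> k < 4 ^ s \<Longrightarrow> (shift ^^ n) k < 4 ^ s"
proof -
  assume s: "12 \<le> s" "k < 4 ^ s"
  have "(shift ^^ n) k < 4 ^ lev k"
    using lev_prop(2)[of "(shift ^^ n) k"] by (simp add: lev_shift_pow)
  also have "(4::nat) ^ lev k \<le> 4 ^ s"
    using lev_le[OF s] by (intro power_increasing) auto
  finally show ?thesis .
qed

section \<open>The operator\<close>

text \<open>\<open>ratio\<close> and \<open>jump\<close> are the matrix entries on the orthonormal
  basis; dividing by \<open>weight k\<close> makes \<open>op_wvec\<close> free of weights.\<close>

definition ratio :: "nat \<Rightarrow> real" where
  "ratio k = weight (shift k) / weight k"

definition jump :: "nat \<Rightarrow> real" where
  "jump k = (phase (shift k) - phase k) / weight k"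

lemma ratio_bounds: "0 \<le> ratio k" "ratio k \<le> 2"
  using weight_pos[of k] weight_pos[of "shift k"] weight_shift[of k]
  by (auto simp: ratio_def field_simps)

lemma phase_diff_le: "\<bar>phase k - phase l\<bar> \<le> 1"
  by (simp add: phase_def)

text \<open>Nonzero jumps occur only at maximal weight, which exceeds the square of every index in
  the level.\<close>

lemma jump_le: "\<bar>jump k\<bar> \<le> 1 / (real (Suc k))\<^sup>2"
proof (cases "phase (shift k) = phase k")
  case False
  define s where "s = lev k"
  note aj = phase_jump[OF False]
  have s: "13 \<le> s" using lev_lower[OF aj(1)] by (simp add: s_def)
  have "real (Suc k) \<le> real (4 ^ s)"
    using lev_prop(2)[of k] unfolding s_def of_nat_le_iff by linarith
  then have "(real (Suc k))\<^sup>2 \<le> (4 ^ s)\<^sup>2"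
    by (intro power_mono) auto
  \<comment> \<open>The 5 in \<open>five_lev\<close> comes from here: squared index bound
    \<open>2 ^ (4 * s)\<close> times the \<open>2 ^ s\<close> in the denominator of the
    weight.\<close>
  also have "(4 ^ s)\<^sup>2 * 2 ^ s = (2::real) ^ (5 * s)"
    by (simp add: power2_eq_square power_mult flip: power_mult_distrib)
  then have "(4 ^ s)\<^sup>2 = (2::real) ^ (5 * s) / 2 ^ s" by (simp add: field_simps)
  also have "\<dots> \<le> height s / 2 ^ s"
  proof (rule divide_right_mono)
    have "(2::real) ^ (5 * s) \<le> 2 ^ (5 * s + 1)" by (rule power_increasing) auto
    also have "\<dots> \<le> height (s - 1)" by (rule height_lower[OF s])
    also have "\<dots> * 1 \<le> height (s - 1) * height (s - 1)"
      using height_ge_1[of "s - 1"] by (intro mult_left_mono) auto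
    then have "height (s - 1) \<le> height s"
      unfolding height_square[OF s] power2_eq_square by simp
    finally show "(2::real) ^ (5 * s) \<le> height s" .
  qed simp
  finally have "(real (Suc k))\<^sup>2 \<le> weight k"
    using aj(2) by (simp add: s_def)
  then have "1 / weight k \<le> 1 / (real (Suc k))\<^sup>2"
    by (intro divide_left_mono mult_pos_pos weight_pos) auto
  moreover have "\<bar>jump k\<bar> \<le> 1 / weight k"
    unfolding jump_def abs_divide using weight_pos[of k] phase_diff_le[of "shift k" k]
    by (simp add: divide_right_mono)
  ultimately show ?thesis by linarith
qed (simp add: jump_def)

lemma summable_jump: "summable (\<lambda>k. \<bar>jump k\<bar>)"
proof (rule summable_comparison_test')
  show "summable (\<lambda>k. 1 / (real (Suc k))\<^sup>2)"
    using inverse_power_summable[of 2, where 'a = real] by (subst summable_Suc_iff) (simp add: field_simps)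
qed (use jump_le in auto)

text \<open>Reindexing by the bijection \<open>inv shift\<close> and \<open>ratio k \<le> 2\<close>.
  Stated for finite sums, it gives both square summability of the image and the norm bound.\<close>

lemma rotation_sums:
  "(\<Sum>m<n. (cmod (complex_of_real (ratio (inv shift m)) * coord x (inv shift m)))\<^sup>2) \<le> (2 * norm x)\<^sup>2"
proof -
  have inj: "inj_on (inv shift) {..<n}"
    using bij_shift by (meson bij_imp_bij_inv bij_is_inj inj_on_subset subset_UNIV)
  have "(\<Sum>m<n. (cmod (complex_of_real (ratio (inv shift m)) * coord x (inv shift m)))\<^sup>2)
      \<le> (\<Sum>m<n. 4 * (cmod (coord x (inv shift m)))\<^sup>2)"
  proof (rule sum_mono)
    fix m
    have "(ratio (inv shift m))\<^sup>2 \<le> 2\<^sup>2"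
      by (intro power_mono ratio_bounds)
    then show "(cmod (complex_of_real (ratio (inv shift m)) * coord x (inv shift m)))\<^sup>2
        \<le> 4 * (cmod (coord x (inv shift m)))\<^sup>2"
      by (simp add: norm_mult power_mult_distrib mult_right_mono)
  qed
  also have "\<dots> = 4 * (\<Sum>k\<in>inv shift ` {..<n}. (cmod (coord x k))\<^sup>2)"
    by (simp add: sum.reindex[OF inj] sum_distrib_left)
  also have "(\<Sum>k\<in>inv shift ` {..<n}. (cmod (coord x k))\<^sup>2) \<le> (norm x)\<^sup>2"
    unfolding norm_ell2_power2 using square_summable_coord[of x]
    by (intro sum_le_suminf) (auto simp: square_summable_def)
  finally show ?thesis by (simp add: power_mult_distrib)
qed

lift_definition rotation :: "ell2 \<Rightarrow> ell2" is
  "\<lambda>f m. complex_of_real (ratio (inv shift m)) * f (inv shift m)"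
proof -
  fix f assume "square_summable f"
  then obtain x where x: "coord x = f" using Abs_ell2_inverse by blast
  show "square_summable (\<lambda>m. complex_of_real (ratio (inv shift m)) * f (inv shift m))"
    unfolding square_summable_def
    by (rule summableI_nonneg_bounded) (use rotation_sums[of x] x in auto)
qed

text \<open>Infinitely many indices share a target, since every level has a block for target 0;
  hence a series of vectors, absolutely convergent by \<open>summable_jump\<close>.\<close>

definition injection :: "ell2 \<Rightarrow> ell2" where
  "injection x = (\<Sum>k. (complex_of_real (jump k) * coord x k) *\<^sub>C basis_vec (target k))"

lemma injection_summable_norm:
  "summable (\<lambda>k. norm ((complex_of_real (jump k) * coord x k) *\<^sub>C basis_vec (target k)))"
  and injection_le: "norm (injection x) \<le> (\<Sum>k. \<bar>jump k\<bar>) * norm x"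
proof -
  have le: "norm ((complex_of_real (jump k) * coord x k) *\<^sub>C basis_vec (target k)) \<le> \<bar>jump k\<bar> * norm x" for k
    by (simp add: norm_mult mult_left_mono norm_coord_le)
  have sm: "summable (\<lambda>k. \<bar>jump k\<bar> * norm x)"
    by (rule summable_mult2[OF summable_jump])
  show s: "summable (\<lambda>k. norm ((complex_of_real (jump k) * coord x k) *\<^sub>C basis_vec (target k)))"
    by (rule summable_comparison_test'[OF sm]) (use le in simp)
  have "norm (injection x) \<le> (\<Sum>k. norm ((complex_of_real (jump k) * coord x k) *\<^sub>C basis_vec (target k)))"
    unfolding injection_def by (rule summable_norm[OF s])
  also have "\<dots> \<le> (\<Sum>k. \<bar>jump k\<bar> * norm x)"
    by (rule suminf_le[OF le s sm])
  also have "\<dots> = (\<Sum>k. \<bar>jump k\<bar>) * norm x"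
    by (rule suminf_mult2[OF summable_jump, symmetric])
  finally show "norm (injection x) \<le> (\<Sum>k. \<bar>jump k\<bar>) * norm x" .
qed

lemmas injection_summable = summable_norm_cancel[OF injection_summable_norm]

definition block_op :: "ell2 \<Rightarrow> ell2" where
  "block_op x = rotation x + injection x"

lemma op_add: "block_op (x + y) = block_op x + block_op y"
proof -
  have "injection (x + y) = injection x + injection y"
    unfolding injection_def suminf_add[OF injection_summable injection_summable]
    by (intro suminf_cong ell2_eqI) (simp add: algebra_simps)
  moreover have "rotation (x + y) = rotation x + rotation y"
    by (intro ell2_eqI) (simp add: rotation.rep_eq algebra_simps)
  ultimately show ?thesis by (simp add: block_op_def)
qed

lemma op_scaleC: "block_op (c *\<^sub>C x) = c *\<^sub>C block_op x"
proof -
  have "injection (c *\<^sub>C x) = (\<Sum>k. c *\<^sub>C ((complex_of_real (jump k) * coord x k) *\<^sub>C basis_vec (target k)))"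
    unfolding injection_def by (intro suminf_cong ell2_eqI) (simp add: algebra_simps)
  also have "\<dots> = c *\<^sub>C injection x"
    unfolding injection_def by (rule bounded_linear.suminf[OF bounded_linear_scaleC injection_summable, symmetric])
  finally show ?thesis
    unfolding block_op_def by (intro ell2_eqI) (simp add: rotation.rep_eq algebra_simps)
qed

lemma op_le: "norm (block_op x) \<le> (2 + (\<Sum>k. \<bar>jump k\<bar>)) * norm x"
proof -
  have "norm (rotation x) \<le> 2 * norm x"
    by (rule norm_le_of_sums) (use rotation_sums[of x] in \<open>auto simp: rotation.rep_eq\<close>)
  then show ?thesis
    using injection_le[of x] norm_triangle_ineq[of "rotation x" "injection x"]
    by (simp add: block_op_def distrib_right)
qed

lemma bounded_linear_block_op: "bounded_linear block_op"
  by (rule bounded_linear_intro[where K = "2 + (\<Sum>k. \<bar>jump k\<bar>)"])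
    (use op_le in \<open>auto simp: op_add op_scaleC scaleR_eq_scaleC mult.commute\<close>)

lemma bounded_clinear_block_op: "bounded_clinear block_op"
proof -
  interpret vector_space scaleC_ell2 by (rule vector_space_scaleC_ell2)
  have "module_hom scaleC_ell2 scaleC_ell2 block_op"
    unfolding module_hom_iff using op_add op_scaleC module_axioms by blast
  then show ?thesis
    unfolding bounded_clinear_def module_hom_iff_linear using op_le by blast
qed

lemma op_basis_vec:
  "block_op (basis_vec k) = ratio k *\<^sub>R basis_vec (shift k) + jump k *\<^sub>R basis_vec (target k)"
proof -
  have "injection (basis_vec k) = (\<Sum>n\<in>{k}. (complex_of_real (jump n) * coord (basis_vec k) n) *\<^sub>C basis_vec (target n))"
    unfolding injection_def by (rule suminf_finite) (auto intro!: ell2_eqI)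
  then have "injection (basis_vec k) = jump k *\<^sub>R basis_vec (target k)"
    by (simp add: scaleR_eq_scaleC)
  moreover have "rotation (basis_vec k) = ratio k *\<^sub>R basis_vec (shift k)"
  proof (rule ell2_eqI)
    fix m
    have "inv shift m = k \<longleftrightarrow> m = shift k"
      using bij_shift by (metis bij_inv_eq_iff)
    then show "coord (rotation (basis_vec k)) m = coord (ratio k *\<^sub>R basis_vec (shift k)) m"
      by (auto simp: rotation.rep_eq scaleR_conv_of_real)
  qed
  ultimately show ?thesis by (simp add: block_op_def)
qed

lemma bounded_linear_block_op_pow: "bounded_linear (block_op ^^ n)"
proof (induction n)
  case (Suc n)
  then show ?case
    using bounded_linear_compose[OF bounded_linear_block_op Suc] by (simp add: o_def)
qed (simp add: id_def bounded_linear_ident)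

lemmas op_pow_linear = bounded_linear.linear[OF bounded_linear_block_op_pow]
lemmas op_pow_simps = linear_add[OF op_pow_linear] linear_diff[OF op_pow_linear]
  linear_sum[OF op_pow_linear] linear_scale[OF op_pow_linear]

lemma op_pow_scaleC: "(block_op ^^ n) (c *\<^sub>C x) = c *\<^sub>C (block_op ^^ n) x"
  by (induction n) (auto simp: op_scaleC)

section \<open>Powers of the operator on the rescaled basis\<close>

definition wvec :: "nat \<Rightarrow> ell2" where
  "wvec k = weight k *\<^sub>R basis_vec k"

lemma op_wvec: "block_op (wvec k) = wvec (shift k) + (phase (shift k) - phase k) *\<^sub>R basis_vec (target k)"
proof -
  have "block_op (wvec k) = weight k *\<^sub>R block_op (basis_vec k)"
    unfolding wvec_def by (rule linear_scale[OF bounded_linear.linear[OF bounded_linear_block_op]])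
  then show ?thesis
    using weight_pos[of k] by (simp add: op_basis_vec wvec_def ratio_def jump_def scaleR_add_right)
qed

lemma basis_vec_eq_wvec: "basis_vec k = (1 / weight k) *\<^sub>R wvec k"
  using weight_pos[of k] by (simp add: wvec_def)

lemma funpow_fixed: "f x = x \<Longrightarrow> (f ^^ n) x = x"
  by (induction n) auto

lemma funpow_dvd_fixed: "(f ^^ d) x = x \<Longrightarrow> d dvd n \<Longrightarrow> (f ^^ n) x = x"
  by (auto simp: dvd_def funpow_mult[symmetric] intro: funpow_fixed)

lemma op_base: "k < 4 ^ 12 \<Longrightarrow> (block_op ^^ n) (basis_vec k) = basis_vec k"
proof (rule funpow_fixed)
  assume "k < 4 ^ 12"
  then have "shift k = k" by (simp add: shift_def)
  then show "block_op (basis_vec k) = basis_vec k"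
    using weight_pos[of k] by (simp add: op_basis_vec ratio_def jump_def)
qed

text \<open>Periodicity of the target is a hypothesis because the formula is needed inside the
  induction that proves it; \<open>op_pow_wvec\<close> then discharges it.\<close>

lemma op_pow_wvec_of_periodic_target:
  assumes k: "4 ^ 12 \<le> k" and per: "(block_op ^^ 2 ^ (lev k - 2)) (basis_vec (target k)) = basis_vec (target k)"
  shows "(block_op ^^ n) (wvec k) = wvec ((shift ^^ n) k) +
    (phase ((shift ^^ n) k) - phase k) *\<^sub>R (block_op ^^ (pos k + n)) (basis_vec (target k))"
proof (induction n)
  case (Suc n)
  define l where "l = (shift ^^ n) k"
  define u where "u = basis_vec (target k)"
  \<comment> \<open>Whenever the phase jumps, \<open>pos k + Suc n\<close> is a multiple of a period
    of \<open>u\<close>. So the injected \<open>u\<close> equals the current point of one fixed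
    orbit, and the phase differences telescope.\<close>
  have jump: "(phase (shift l) - phase l) *\<^sub>R u = (phase (shift l) - phase l) *\<^sub>R (block_op ^^ (pos k + Suc n)) u"
  proof (cases "phase (shift l) = phase l")
    case False
    let ?d = "2 ^ (lev k - 2) :: nat"
    have "?d dvd pos l + 1"
      using phase_jump(3)[OF False] by (simp add: l_def lev_shift_pow)
    then have "?d dvd (pos k + n) mod 2 ^ lev k + 1"
      using pos_shift_pow[OF k] by (simp add: l_def)
    moreover have "?d dvd 2 ^ lev k" by (rule le_imp_power_dvd) simp
    then have "(pos k + n) mod 2 ^ lev k mod ?d = (pos k + n) mod ?d"
      by (rule mod_mod_cancel)
    then have "((pos k + n) mod 2 ^ lev k + 1) mod ?d = (pos k + n + 1) mod ?d"
      by (rule mod_add_cong) (rule refl)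
    ultimately have "?d dvd pos k + n + 1"
      by (simp only: dvd_eq_mod_eq_0)
    then have "?d dvd pos k + Suc n" by simp
    then have "(block_op ^^ (pos k + Suc n)) u = u"
      unfolding u_def by (rule funpow_dvd_fixed[OF per])
    then show ?thesis by (simp only:)
  qed simp
  have "(block_op ^^ Suc n) (wvec k) = block_op (wvec l + (phase l - phase k) *\<^sub>R (block_op ^^ (pos k + n)) u)"
    using Suc by (simp add: l_def u_def)
  also have "\<dots> = block_op (wvec l) + (phase l - phase k) *\<^sub>R (block_op ^^ (pos k + Suc n)) u"
    by (simp add: op_add op_scaleC scaleR_eq_scaleC)
  also have "block_op (wvec l) = wvec (shift l) + (phase (shift l) - phase l) *\<^sub>R (block_op ^^ (pos k + Suc n)) u"
    unfolding op_wvec[of l] jump[symmetric] by (simp only: l_def u_def target_shift_pow)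
  also have "\<dots> + (phase l - phase k) *\<^sub>R (block_op ^^ (pos k + Suc n)) u =
      wvec (shift l) + (phase (shift l) - phase k) *\<^sub>R (block_op ^^ (pos k + Suc n)) u"
    by (simp only: algebra_simps)
  finally show ?case
    by (simp only: l_def u_def funpow.simps comp_apply)
qed simp

text \<open>After one turn of the block the phase is back at its initial value, so the injected term
  vanishes. The target has lower level, so induction supplies its period.\<close>

lemma op_periodic_basis: "k < 4 ^ t \<Longrightarrow> (block_op ^^ 2 ^ t) (basis_vec k) = basis_vec k"
proof (induction t arbitrary: k rule: less_induct)
  case (less t)
  show ?case
  proof (cases "k < 4 ^ 12")
    case False
    then have k: "4 ^ 12 \<le> k" by simp
    have "12 \<le> t"
    proof (rule ccontr)
      assume "\<not> 12 \<le> t"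
      then have "(4::nat) ^ t \<le> 4 ^ 12" by (intro power_increasing) auto
      then show False using k less.prems by linarith
    qed
    then have lt: "lev k \<le> t" using less.prems by (rule lev_le)
    moreover have l12: "12 < lev k" using lev_lower[OF k] by simp
    ultimately have "(block_op ^^ 2 ^ (lev k - 2)) (basis_vec (target k)) = basis_vec (target k)"
      using target_less[OF k] by (intro less.IH) auto
    note form = op_pow_wvec_of_periodic_target[OF k this]
    obtain a where a: "k = a + pos k" "2 ^ lev k dvd a" "4 ^ (lev k - 1) \<le> a"
      "a < 4 ^ lev k" "pos k < 2 ^ lev k" "12 < lev k"
      using block_decomp[OF k] by auto
    have "(shift ^^ 2 ^ lev k) k = k"
      using shift_block[OF a(6,2-5), of "2 ^ lev k"] a(1) a(5) by simp
    then have "(block_op ^^ 2 ^ lev k) (wvec k) = wvec k"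
      by (simp add: form)
    then have "(block_op ^^ 2 ^ t) (wvec k) = wvec k"
      using lt by (rule funpow_dvd_fixed[OF _ le_imp_power_dvd])
    then show ?thesis by (simp add: basis_vec_eq_wvec op_pow_simps)
  qed (rule op_base)
qed

lemma op_pow_wvec:
  assumes k: "4 ^ 12 \<le> k"
  shows "(block_op ^^ n) (wvec k) = wvec ((shift ^^ n) k) +
    (phase ((shift ^^ n) k) - phase k) *\<^sub>R (block_op ^^ (pos k + n)) (basis_vec (target k))"
  using k op_periodic_basis[OF target_less[OF k]] by (rule op_pow_wvec_of_periodic_target)

lemma supp_below_expand:
  "supp_below M x \<Longrightarrow> x = (\<Sum>k<M. coord x k *\<^sub>C basis_vec k)"
  using trunc_of_supp_below[of M x] by (simp add: trunc_def)

lemma op_periodic: "supp_below (4 ^ t) x \<Longrightarrow> (block_op ^^ 2 ^ t) x = x"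
proof -
  assume x: "supp_below (4 ^ t) x"
  have "(block_op ^^ 2 ^ t) x = (\<Sum>k<4 ^ t. (block_op ^^ 2 ^ t) (coord x k *\<^sub>C basis_vec k))"
    by (subst supp_below_expand[OF x]) (simp only: op_pow_simps)
  also have "\<dots> = (\<Sum>k<4 ^ t. coord x k *\<^sub>C basis_vec k)"
    by (intro sum.cong) (auto simp: op_pow_scaleC op_periodic_basis)
  also have "\<dots> = x" by (rule supp_below_expand[OF x, symmetric])
  finally show ?thesis .
qed

lemma op_supp_below:
  assumes s: "12 \<le> s" and x: "supp_below (4 ^ s) x"
  shows "supp_below (4 ^ s) ((block_op ^^ n) x)"
proof (induction n)
  case (Suc n)
  define y where "y = (block_op ^^ n) x"
  have y: "supp_below (4 ^ s) y" using Suc by (simp add: y_def)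
  have bv: "supp_below (4 ^ s) (block_op (basis_vec k))" if k: "k < 4 ^ s" for k
  proof -
    have "shift k < 4 ^ s" using shift_pow_less[OF s k, of 1] by simp
    moreover have "target k \<le> k" unfolding target_def by (meson diff_le_self div_le_dividend le_trans)
    ultimately show ?thesis
      unfolding op_basis_vec using k by (intro supp_below_add supp_below_scaleR supp_below_basis_vec) auto
  qed
  have "block_op y = (\<Sum>k<4 ^ s. block_op (coord y k *\<^sub>C basis_vec k))"
    by (subst supp_below_expand[OF y]) (rule linear_sum[OF bounded_linear.linear[OF bounded_linear_block_op]])
  moreover have "supp_below (4 ^ s) (\<Sum>k<4 ^ s. block_op (coord y k *\<^sub>C basis_vec k))"
    by (rule supp_below_sum) (use bv in \<open>auto simp: op_scaleC intro!: supp_below_scaleC\<close>)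
  ultimately show ?case by (simp add: y_def)
qed (use x in simp)

lemma height_mono: "s \<le> t \<Longrightarrow> height s \<le> height t"
  unfolding height_def by (intro power_increasing) auto

lemma weight_le: "4 ^ 12 \<le> k \<Longrightarrow> weight k \<le> height (lev k) / 2 ^ lev k"
  and weight_ge: "4 ^ 12 \<le> k \<Longrightarrow> 1 / 2 ^ lev k \<le> weight k"
  using profile_bounds[of "lev k" "pos k"] by (auto simp: weight_def)

text \<open>Moving from weight at least \<open>1 / 2 ^ s\<close> to weight at most
  \<open>height s / 2 ^ s\<close> costs a factor \<open>height s\<close>. The injected orbit costs
  at most \<open>2 ^ s * (2 * height r)\<close> with \<open>r = s - 1\<close>, which the squaring of
  heights absorbs into a second \<open>height s\<close>.\<close>

lemma orbit_bound: "12 \<le> s \<Longrightarrow> k < 4 ^ s \<Longrightarrow> norm ((block_op ^^ n) (basis_vec k)) \<le> 2 * height s"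
proof (induction s arbitrary: k n rule: dec_induct)
  case base
  then show ?case using height_ge_1[of 12] by (simp add: op_base)
next
  case (step r)
  define s where "s = Suc r"
  have s: "13 \<le> s" "s - 1 = r" using step.hyps by (auto simp: s_def)
  show ?case
  proof (cases "k < 4 ^ r")
    case True
    then show ?thesis using step.IH[of k n] height_mono[of r "Suc r"] by simp
  next
    case False
    have ls: "lev k = s" using s False step.prems by (intro lev_eqI) (auto simp: s_def)
    have k: "4 ^ 12 \<le> k"
    proof -
      have "(4::nat) ^ 12 \<le> 4 ^ r" using step.hyps by (intro power_increasing) auto
      then show ?thesis using False by linarith
    qed
    have kn: "4 ^ 12 \<le> (shift ^^ n) k"
    proof -
      have "(4::nat) ^ 12 \<le> 4 ^ r" using step.hyps by (intro power_increasing) auto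
      then show ?thesis using shift_pow_ge[OF k, of n] ls s(2) by simp
    qed
    have "target k < 4 ^ r"
    proof -
      have "(4::nat) ^ (s - 2) \<le> 4 ^ r" by (intro power_increasing) (auto simp: s_def)
      then show ?thesis using target_less[OF k] ls by (metis less_le_trans)
    qed
    then have u: "norm ((block_op ^^ (pos k + n)) (basis_vec (target k))) \<le> 2 * height r"
      by (rule step.IH)
    have "norm ((block_op ^^ n) (wvec k)) \<le> norm (wvec ((shift ^^ n) k)) +
        norm ((phase ((shift ^^ n) k) - phase k) *\<^sub>R (block_op ^^ (pos k + n)) (basis_vec (target k)))"
      unfolding op_pow_wvec[OF k] by (rule norm_triangle_ineq)
    also have "norm (wvec ((shift ^^ n) k)) \<le> height s / 2 ^ s"
      using weight_le[OF kn] weight_pos[of "(shift ^^ n) k"] by (simp add: wvec_def lev_shift_pow ls)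
    also have "norm ((phase ((shift ^^ n) k) - phase k) *\<^sub>R (block_op ^^ (pos k + n)) (basis_vec (target k)))
        \<le> 1 * (2 * height r)"
      unfolding norm_scaleR by (intro mult_mono phase_diff_le u) auto
    finally have 1: "norm ((block_op ^^ n) (wvec k)) \<le> height s / 2 ^ s + 2 * height r" by simp
    have "2 ^ s * (2 * height r) \<le> height s"
    proof -
      have "(2::real) ^ s * 2 = 2 ^ Suc s" by simp
      also have "\<dots> \<le> 2 ^ (5 * s + 1)" by (rule power_increasing) auto
      also have "\<dots> \<le> height r" using height_lower[OF s(1)] s(2) by simp
      finally have "2 ^ s * 2 * height r \<le> height r * height r"
        using height_ge_1[of r] by (intro mult_right_mono) auto
      then show ?thesis
        using height_square[OF s(1)] s(2) by (simp add: power2_eq_square mult.assoc)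
    qed
    then have "2 ^ s * (height s / 2 ^ s + 2 * height r) \<le> 2 * height s"
      by (simp add: distrib_left)
    moreover have "norm ((block_op ^^ n) (basis_vec k)) = (1 / weight k) * norm ((block_op ^^ n) (wvec k))"
      using weight_pos[of k] by (simp add: basis_vec_eq_wvec[of k] op_pow_simps)
    moreover have "(1 / weight k) * norm ((block_op ^^ n) (wvec k)) \<le> 2 ^ s * (height s / 2 ^ s + 2 * height r)"
      using weight_ge[OF k] weight_pos[of k] ls by (intro mult_mono 1) (auto simp: field_simps)
    ultimately show ?thesis by (simp add: s_def)
  qed
qed

section \<open>Chaos and mixing\<close>

lemma le_four_power: "M \<le> t \<Longrightarrow> M \<le> (4::nat) ^ t"
proof -
  assume "M \<le> t"
  moreover have "t < 4 ^ t" by (induction t) auto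
  ultimately show ?thesis by linarith
qed

lemma periodic_points_dense: "closure {x. periodic_point block_op x} = UNIV"
  unfolding closure_eq_UNIV_iff
proof (intro allI impI)
  fix U :: "ell2 set" assume "open U \<and> U \<noteq> {}"
  then obtain x where "open U" "x \<in> U" by blast
  then obtain M y where y: "supp_below M y" "y \<in> U"
    using open_contains_supp_below by blast
  have "(block_op ^^ 2 ^ M) y = y"
    by (intro op_periodic supp_below_mono[OF y(1)] le_four_power order_refl)
  then have "periodic_point block_op y"
    unfolding periodic_point_def by (intro exI[of _ "2 ^ M"]) simp
  then show "{x. periodic_point block_op x} \<inter> U \<noteq> {}" using y(2) by blast
qed

lemma orbit_bound_supp:
  assumes "12 \<le> s" "supp_below (4 ^ s) x"
  shows "norm ((block_op ^^ n) x) \<le> (\<Sum>k<4 ^ s. cmod (coord x k)) * (2 * height s)"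
proof -
  have "(block_op ^^ n) x = (\<Sum>k<4 ^ s. coord x k *\<^sub>C (block_op ^^ n) (basis_vec k))"
    by (subst supp_below_expand[OF assms(2)]) (simp only: op_pow_simps op_pow_scaleC)
  also have "norm \<dots> \<le> (\<Sum>k<4 ^ s. cmod (coord x k) * (2 * height s))"
    by (rule sum_norm_le) (use orbit_bound[OF assms(1)] in \<open>auto intro!: mult_left_mono\<close>)
  finally show ?thesis by (simp add: sum_distrib_right)
qed

text \<open>The intervals \<open>(5 * 2 ^ r, 10 * 2 ^ r]\<close> abut, so every large time is a
  steering time of some level \<open>r + 5\<close>.\<close>

lemma window_exists:
  fixes i :: nat
  assumes "10 * 2 ^ S < i"
  obtains r where "S < r" "5 * 2 ^ r < i" "i \<le> 10 * 2 ^ r"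
proof -
  define r where "r = (LEAST r. i \<le> 10 * 2 ^ r)"
  have "i < 2 ^ i" by (rule less_exp)
  then have "i \<le> 10 * 2 ^ i" by linarith
  then have r: "i \<le> 10 * 2 ^ r" unfolding r_def by (rule LeastI)
  have "S < r"
  proof (rule ccontr)
    assume "\<not> S < r"
    then have "(2::nat) ^ r \<le> 2 ^ S" by (intro power_increasing) auto
    then show False using r assms by linarith
  qed
  then obtain q where q: "r = Suc q" using less_imp_Suc_add by blast
  have "\<not> i \<le> 10 * 2 ^ q"
  proof
    assume "i \<le> 10 * 2 ^ q"
    then have "r \<le> q" unfolding r_def by (rule Least_le)
    then show False using q by simp
  qed
  then have "5 * 2 ^ r < i" using q by simp
  with \<open>S < r\<close> r show ?thesis using that by blast
qed

text \<open>Travel from the light part of the first arc to the light part of the second in a block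
  with target \<open>m\<close>: both ends have weight \<open>1 / 2 ^ s\<close>, while the phase
  rises from 0 to 1 and releases \<open>basis_vec m\<close>.\<close>

lemma steer_to_basis_vec:
  assumes s: "12 < s" "2 * t + 2 \<le> s" "t + 5 \<le> s"
    and i: "5 * 2 ^ (s - 5) < i" "i \<le> 10 * 2 ^ (s - 5)" and m: "m < 4 ^ t"
  obtains z where "norm z \<le> 1 / 2 ^ s" "norm ((block_op ^^ i) z - basis_vec m) \<le> 1 / 2 ^ s"
proof -
  define R :: nat where "R = 2 ^ (s - 5)"
  have L: "2 ^ s = 32 * R" and Q: "2 ^ (s - 2) = 8 * R"
    using s two_power_split[of s] by (simp_all add: R_def)
  have R: "R > 0" by (simp add: R_def)
  \<comment> \<open>The landing position: a multiple of \<open>R\<close>, hence of the period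
    \<open>2 ^ t\<close> of \<open>basis_vec m\<close>, in \<open>[8 R, 11 R)\<close>, with
    \<open>q - i\<close> in \<open>[0, 3 R)\<close>.\<close>
  define q where "q = (if i \<le> 8 * R then 8 * R else if i \<le> 9 * R then 9 * R else 10 * R)"
  define j where "j = q - i"
  have q: "8 * R \<le> q" "q < 11 * R" "R dvd q" "i \<le> q" and j: "j < 3 * R" "j + i = q"
    using i R unfolding q_def j_def R_def[symmetric] by auto
  have qL: "q < 2 ^ s" and jL: "j < 2 ^ s" using q(2) j(1) R by (auto simp only: L)
  \<comment> \<open>Start of the block numbered \<open>2 ^ (s - 2) + m\<close>, whose target is
    \<open>m\<close>.\<close>
  define a where "a = (2 ^ (s - 2) + m) * 2 ^ s"
  have "(4::nat) ^ t = 2 ^ (2 * t)" by (simp add: power_mult)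
  also have "\<dots> \<le> 2 ^ (s - 2)" using s(2) by (intro power_increasing) auto
  finally have mQ: "m < 2 ^ (s - 2)" using m by simp
  have four: "(4::nat) ^ n = 2 ^ n * 2 ^ n" for n
    by (simp flip: power_mult_distrib)
  have a: "2 ^ s dvd a" "4 ^ (s - 1) \<le> a" "a < 4 ^ s"
  proof -
    show "2 ^ s dvd a" by (simp add: a_def)
    have "(4::nat) ^ (s - 1) = 2 ^ (2 * (s - 1))" by (simp add: power_mult)
    also have "2 * (s - 1) = s - 2 + s" using s(1) by linarith
    also have "(2::nat) ^ (s - 2 + s) = 2 ^ (s - 2) * 2 ^ s" by (rule power_add)
    also have "\<dots> \<le> a" unfolding a_def by (rule mult_right_mono) auto
    finally show "4 ^ (s - 1) \<le> a" .
    have "2 ^ (s - 2) + m < 2 ^ s" using mQ R unfolding L Q by linarith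
    then show "a < 4 ^ s" unfolding a_def four by (intro mult_strict_right_mono) auto
  qed
  note bj = block_index[OF s(1) a jL] and bq = block_index[OF s(1) a qL]
  define k where "k = a + j"
  have sk: "(shift ^^ i) k = a + q"
    using shift_block[OF s(1) a jL, of i] j(2) qL by (simp add: k_def)
  have k: "4 ^ 12 \<le> k" "4 ^ 12 \<le> a + q" using bj(3) by (simp_all add: k_def)
  have "k div 2 ^ s = 2 ^ (s - 2) + m"
    using jL by (simp add: k_def a_def)
  then have tk: "target k = m"
    using bj(1) by (simp add: target_def k_def)
  have wk: "weight k = 1 / 2 ^ s" "weight (a + q) = 1 / 2 ^ s"
  proof -
    have "profile s j = 1 / 2 ^ s" "profile s q = 1 / 2 ^ s"
      using j(1) q(1,2) R by (simp_all add: profile_def Let_def flip: R_def)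
    then show "weight k = 1 / 2 ^ s" "weight (a + q) = 1 / 2 ^ s"
      using bj bq k by (simp_all add: weight_def k_def)
  qed
  have ph: "phase (a + q) = 1" "phase k = 0"
    using bj bq q(1) j(1) by (simp_all add: phase_def k_def Q)
  have "(block_op ^^ R) (basis_vec m) = basis_vec m"
  proof (rule funpow_dvd_fixed[OF op_periodic_basis[OF m]])
    show "2 ^ t dvd R" unfolding R_def using s(3) by (intro le_imp_power_dvd) simp
  qed
  then have "(block_op ^^ q) (basis_vec m) = basis_vec m"
    using q(3) by (rule funpow_dvd_fixed)
  then have "(block_op ^^ i) (wvec k) = wvec (a + q) + basis_vec m"
    using op_pow_wvec[OF k(1), of i] bj(2) j(2) by (simp add: sk tk ph k_def[symmetric])
  then show ?thesis
    using wk by (intro that[of "wvec k"]) (simp_all add: wvec_def)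
qed

text \<open>Linear combination of the steering vectors. The time \<open>i0\<close> is uniform over a
  ball because in the mixing argument the vector to be reached changes with
  \<open>i\<close>.\<close>

lemma steer_to_bounded:
  assumes t: "12 \<le> t" and e: "0 < e" and K: "0 \<le> K"
  obtains i0 where "\<And>i y. i0 \<le> i \<Longrightarrow> supp_below (4 ^ t) y \<Longrightarrow> norm y \<le> K \<Longrightarrow>
    \<exists>z. norm z < e \<and> norm ((block_op ^^ i) z - y) < e"
proof -
  obtain S0 where S0: "4 ^ t * K / e < 2 ^ S0"
    using real_arch_pow[of 2 "4 ^ t * K / e"] by auto
  \<comment> \<open>\<open>S0\<close> makes the total error of \<open>4 ^ t\<close> terms smaller
    than \<open>e\<close>; the rest ensures the level conditions of
    \<open>steer_to_basis_vec\<close>.\<close>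
  define S where "S = S0 + 2 * t + 13"
  have ex: "\<exists>z. norm z < e \<and> norm ((block_op ^^ i) z - y) < e"
    if i: "Suc (10 * 2 ^ S) \<le> i" and y: "supp_below (4 ^ t) y" "norm y \<le> K" for i y
  proof -
    obtain r where r: "S < r" "5 * 2 ^ r < i" "i \<le> 10 * 2 ^ r"
      using window_exists[of S i] i by auto
    define s where "s = r + 5"
    have sr: "s - 5 = r" by (simp add: s_def)
    have "\<exists>z. norm z \<le> 1 / 2 ^ s \<and> norm ((block_op ^^ i) z - basis_vec m) \<le> 1 / 2 ^ s" if m: "m < 4 ^ t" for m
      by (rule steer_to_basis_vec[of s t i m]) (use r m sr in \<open>auto simp: s_def S_def\<close>)
    then obtain z where z: "\<And>m. m < 4 ^ t \<Longrightarrow> norm (z m) \<le> 1 / 2 ^ s"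
      "\<And>m. m < 4 ^ t \<Longrightarrow> norm ((block_op ^^ i) (z m) - basis_vec m) \<le> 1 / 2 ^ s"
      by metis
    have small: "(\<Sum>m<(4::nat) ^ t. K * (1 / 2 ^ s)) < e"
    proof -
      have "4 ^ t * K < e * 2 ^ S0" using S0 e by (simp add: field_simps)
      also have "\<dots> \<le> e * 2 ^ s"
        using e r(1) by (intro mult_left_mono power_increasing) (auto simp: s_def S_def)
      finally show ?thesis by (simp add: field_simps)
    qed
    have cy: "cmod (coord y m) \<le> K" for m
      using norm_coord_le[of y m] y(2) by linarith
    define Z where "Z = (\<Sum>m<4 ^ t. coord y m *\<^sub>C z m)"
    have "norm Z \<le> (\<Sum>m<(4::nat) ^ t. K * (1 / 2 ^ s))"
      unfolding Z_def by (rule sum_norm_le) (use z(1) cy K in \<open>auto simp only: norm_scaleC norm_ge_zero intro!: mult_mono\<close>)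
    moreover have "norm ((block_op ^^ i) Z - y) \<le> (\<Sum>m<(4::nat) ^ t. K * (1 / 2 ^ s))"
    proof -
      have "(block_op ^^ i) Z - y = (\<Sum>m<4 ^ t. coord y m *\<^sub>C (block_op ^^ i) (z m)) - (\<Sum>m<4 ^ t. coord y m *\<^sub>C basis_vec m)"
        unfolding Z_def op_pow_simps op_pow_scaleC by (subst supp_below_expand[OF y(1)]) (rule refl)
      also have "\<dots> = (\<Sum>m<4 ^ t. coord y m *\<^sub>C ((block_op ^^ i) (z m) - basis_vec m))"
        unfolding sum_subtractf[symmetric] by (intro sum.cong refl ell2_eqI) (simp add: algebra_simps)
      also have "norm \<dots> \<le> (\<Sum>m<(4::nat) ^ t. K * (1 / 2 ^ s))"
        by (rule sum_norm_le) (use z(2) cy K in \<open>auto simp only: norm_scaleC norm_ge_zero intro!: mult_mono\<close>)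
      finally show ?thesis .
    qed
    ultimately show ?thesis using small by (intro exI[of _ Z]) linarith
  qed
  show ?thesis by (rule that[of "Suc (10 * 2 ^ S)"]) (use ex in blast)
qed

text \<open>Perturb \<open>u\<close> by a small \<open>z\<close> steered to
  \<open>v - T ^ i u\<close>, where \<open>T\<close> is \<open>block_op\<close>. These vectors stay
  bounded and supported in fixed levels, so one \<open>i0\<close> serves all later times.\<close>

lemma mixing_block_op: "mixing block_op"
  unfolding mixing_def
proof (intro allI impI)
  fix U V :: "ell2 set"
  assume UV: "open U \<and> U \<noteq> {} \<and> open V \<and> V \<noteq> {}"
  obtain M u where u: "supp_below M u" "u \<in> U"
    using UV open_contains_supp_below by blast
  obtain N v where v: "supp_below N v" "v \<in> V"
    using UV open_contains_supp_below by blast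
  define t where "t = M + N + 12"
  have t: "12 \<le> t" by (simp add: t_def)
  have "M \<le> 4 ^ t" "N \<le> 4 ^ t"
    by (auto intro!: le_four_power simp only: t_def)
  then have su: "supp_below (4 ^ t) u" and sv: "supp_below (4 ^ t) v"
    using supp_below_mono u(1) v(1) by blast+
  obtain e1 where e1: "e1 > 0" "ball u e1 \<subseteq> U" using UV u(2) openE by blast
  obtain e2 where e2: "e2 > 0" "ball v e2 \<subseteq> V" using UV v(2) openE by blast
  define e where "e = min e1 e2"
  have e: "0 < e" using e1 e2 by (simp add: e_def)
  define B where "B = (\<Sum>k<4 ^ t. cmod (coord u k)) * (2 * height t)"
  have B: "norm ((block_op ^^ i) u) \<le> B" for i
    unfolding B_def by (rule orbit_bound_supp[OF t su])
  have "0 \<le> norm v + B" using B[of 0] by (simp add: order_trans[OF norm_ge_zero])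
  from steer_to_bounded[OF t e this] obtain i0 where
    i0: "\<And>i y. i0 \<le> i \<Longrightarrow> supp_below (4 ^ t) y \<Longrightarrow> norm y \<le> norm v + B \<Longrightarrow>
      \<exists>z. norm z < e \<and> norm ((block_op ^^ i) z - y) < e"
    by blast
  have "i \<in> return_set block_op U V" if i: "i0 \<le> i" for i
  proof -
    have "norm (v - (block_op ^^ i) u) \<le> norm v + B"
      using norm_triangle_ineq4[of v "(block_op ^^ i) u"] B[of i] by linarith
    then obtain z where z: "norm z < e" "norm ((block_op ^^ i) z - (v - (block_op ^^ i) u)) < e"
      using i0[OF i supp_below_diff[OF sv op_supp_below[OF t su]]] by blast
    have "u + z \<in> U" using z(1) e1(2) by (auto simp: e_def dist_norm subset_iff)
    moreover have "(block_op ^^ i) (u + z) \<in> V"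
    proof -
      have "(block_op ^^ i) (u + z) - v = (block_op ^^ i) z - (v - (block_op ^^ i) u)"
        by (simp add: op_pow_simps)
      then have "norm ((block_op ^^ i) (u + z) - v) < e2"
        using z(2) by (simp only: e_def min_less_iff_conj)
      then have "dist v ((block_op ^^ i) (u + z)) < e2"
        by (simp only: dist_norm norm_minus_commute)
      then show ?thesis using e2(2) by auto
    qed
    ultimately show ?thesis by (auto simp: return_set_def)
  qed
  then have "- return_set block_op U V \<subseteq> {..<i0}" using not_less by blast
  then show "finite (- return_set block_op U V)" by (rule finite_subset) simp
qed

section \<open>Failure of disjoint transitivity\<close>

lemma trunc_add: "trunc M (x + y) = trunc M x + trunc M y"
  by (intro ell2_eqI) simp

lemma trunc_diff: "trunc M (x - y) = trunc M x - trunc M y"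
  by (intro ell2_eqI) simp

text \<open>Descending from level \<open>s\<close> to \<open>s - 1\<close> gains
  \<open>1 / 2 ^ s\<close>, the error allowed there. The value is below \<open>1 / 2\<close> at
  level 12 and above \<open>1 / 4\<close> at every level.\<close>

definition threshold :: "nat \<Rightarrow> real" where
  "threshold s = 1 / 4 + 1 / 2 ^ s"

text \<open>Induction on the highest level \<open>s\<close>: removing it changes the lower
  coordinates at times \<open>n\<close> and \<open>2 * n\<close> by at most
  \<open>1 / 2 ^ s\<close>, so the truncated vector satisfies the hypotheses one level down.\<close>

lemma no_double_return:
  assumes "12 \<le> s" "supp_below (4 ^ s) x"
    and "norm x < threshold s" "norm ((block_op ^^ n) x) < threshold s"
      "norm ((block_op ^^ (2 * n)) x - basis_vec 0) < threshold s"
  shows False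
  using assms
proof (induction s arbitrary: x rule: dec_induct)
  case base
  have fix12: "(block_op ^^ m) x = x" for m
  proof -
    have "(block_op ^^ m) x = (\<Sum>k<4 ^ 12. coord x k *\<^sub>C (block_op ^^ m) (basis_vec k))"
      by (subst supp_below_expand[OF base(1)]) (simp only: op_pow_simps op_pow_scaleC)
    also have "\<dots> = (\<Sum>k<4 ^ 12. coord x k *\<^sub>C basis_vec k)"
      by (intro sum.cong refl) (use op_base in auto)
    finally show ?thesis using supp_below_expand[OF base(1)] by simp
  qed
  \<comment> \<open>On the base the operator is the identity, so \<open>x\<close> would be within
    \<open>1 / 2\<close> of both 0 and a unit vector.\<close>
  have "1 \<le> norm x + norm (x - basis_vec 0)"
    using norm_triangle_ineq4[of x "x - basis_vec 0"] by simp
  moreover have "threshold 12 \<le> 1 / 2" by (simp add: threshold_def)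
  ultimately show False using base(2-) by (simp add: fix12)
next
  case (step r)
  define s where "s = Suc r"
  have s: "12 < s" "13 \<le> s" "s - 1 = r" using step.hyps by (auto simp: s_def)
  define N :: nat where "N = 4 ^ r"
  define A where "A = {N..<4 ^ s}"
  have lev_A: "lev k = s" and A_ge: "4 ^ 12 \<le> k" if "k \<in> A" for k
  proof -
    show "lev k = s" using that s by (intro lev_eqI) (auto simp: A_def N_def)
    have "(4::nat) ^ 12 \<le> N" unfolding N_def using step.hyps by (intro power_increasing) auto
    then show "4 ^ 12 \<le> k" using that by (simp add: A_def)
  qed
  have shift_A: "N \<le> (shift ^^ m) k" if "k \<in> A" for k m
    using shift_pow_ge[OF A_ge[OF that], of m] lev_A[OF that] s(3) by (simp add: N_def)
  \<comment> \<open>Coefficients with respect to \<open>wvec\<close>: they are carried along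
    unchanged by \<open>shift\<close>, and only the weights vary.\<close>
  define c where "c k = coord x k / complex_of_real (weight k)" for k
  define y where "y = trunc N x"
  \<comment> \<open>Everything that level \<open>s\<close> has injected into lower levels up to time
    \<open>m\<close>.\<close>
  define I where "I m = (\<Sum>k\<in>A. c k *\<^sub>C ((phase ((shift ^^ m) k) - phase k) *\<^sub>R
      (block_op ^^ (pos k + m)) (basis_vec (target k))))" for m
  have y: "supp_below N y" unfolding y_def by (rule supp_below_trunc)
  have c_wvec: "c k *\<^sub>C wvec k = coord x k *\<^sub>C basis_vec k" for k
    using weight_pos[of k] by (intro ell2_eqI) (simp add: c_def wvec_def scaleR_conv_of_real)
  have "x = (\<Sum>k<4 ^ s. coord x k *\<^sub>C basis_vec k)"
    using step.prems(1) unfolding s_def by (rule supp_below_expand)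
  also have "{..<4 ^ s} = {..<N} \<union> A"
    unfolding A_def N_def s_def by auto
  also have "(\<Sum>k\<in>{..<N} \<union> A. coord x k *\<^sub>C basis_vec k) = y + (\<Sum>k\<in>A. c k *\<^sub>C wvec k)"
    unfolding y_def trunc_def c_wvec by (rule sum.union_disjoint) (auto simp: A_def)
  finally have x: "x = y + (\<Sum>k\<in>A. c k *\<^sub>C wvec k)" .
  have pow_x: "(block_op ^^ m) x = (block_op ^^ m) y + I m + (\<Sum>k\<in>A. c k *\<^sub>C wvec ((shift ^^ m) k))" for m
  proof -
    have "(block_op ^^ m) x = (block_op ^^ m) y + (\<Sum>k\<in>A. c k *\<^sub>C (block_op ^^ m) (wvec k))"
      by (subst x) (simp only: op_pow_simps op_pow_scaleC)
    also have "(\<Sum>k\<in>A. c k *\<^sub>C (block_op ^^ m) (wvec k)) = I m + (\<Sum>k\<in>A. c k *\<^sub>C wvec ((shift ^^ m) k))"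
      unfolding I_def sum.distrib[symmetric]
    proof (intro sum.cong refl)
      fix k assume "k \<in> A"
      show "c k *\<^sub>C (block_op ^^ m) (wvec k) = c k *\<^sub>C ((phase ((shift ^^ m) k) - phase k) *\<^sub>R
          (block_op ^^ (pos k + m)) (basis_vec (target k))) + c k *\<^sub>C wvec ((shift ^^ m) k)"
        unfolding op_pow_wvec[OF A_ge[OF \<open>k \<in> A\<close>], of m]
        by (intro ell2_eqI) (simp add: distrib_left)
    qed
    finally show ?thesis by simp
  qed
  have low: "supp_below N ((block_op ^^ m) y + I m)" for m
  proof -
    have "supp_below N ((block_op ^^ l) (basis_vec (target k)))" if k: "k \<in> A" for k l
    proof -
      have "(4::nat) ^ (s - 2) \<le> 4 ^ r" by (intro power_increasing) (auto simp: s_def)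
      then have "target k < 4 ^ r" using target_less[OF A_ge[OF k]] lev_A[OF k] by (metis less_le_trans)
      then show ?thesis
        unfolding N_def using step.hyps by (intro op_supp_below supp_below_basis_vec) auto
    qed
    then have "supp_below N (I m)"
      unfolding I_def by (intro supp_below_sum supp_below_scaleC supp_below_scaleR)
    moreover have "supp_below N ((block_op ^^ m) y)"
      using op_supp_below[of r y m] y step.hyps by (simp add: N_def)
    ultimately show ?thesis by (intro supp_below_add)
  qed
  have trunc_pow: "trunc N ((block_op ^^ m) x) = (block_op ^^ m) y + I m" for m
  proof -
    have "trunc N (\<Sum>k\<in>A. c k *\<^sub>C wvec ((shift ^^ m) k)) = 0"
    proof (rule ell2_eqI)
      fix l
      have "coord (wvec ((shift ^^ m) k)) l = 0" if "k \<in> A" "l < N" for k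
        using shift_A[OF that(1), of m] that(2) by (auto simp: wvec_def)
      then show "coord (trunc N (\<Sum>k\<in>A. c k *\<^sub>C wvec ((shift ^^ m) k))) l = coord 0 l"
        by (auto intro!: sum.neutral)
    qed
    then have "trunc N ((block_op ^^ m) x) = trunc N ((block_op ^^ m) y + I m)"
      by (simp only: pow_x[of m] trunc_add[of N "(block_op ^^ m) y + I m"] add_0_right)
    then show ?thesis by (simp only: trunc_of_supp_below[OF low])
  qed
  have coord_pow: "coord ((block_op ^^ m) x) ((shift ^^ m) k) = c k * weight ((shift ^^ m) k)" if k: "k \<in> A" for k m
  proof -
    have inj: "inj (shift ^^ m)" using bij_shift bij_is_inj inj_fn by blast
    have "coord ((block_op ^^ m) x) ((shift ^^ m) k) = (\<Sum>l\<in>A. c l * coord (wvec ((shift ^^ m) l)) ((shift ^^ m) k))"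
      using low[of m] shift_A[OF k, of m] unfolding pow_x by (simp add: supp_below_def)
    also have "\<dots> = (\<Sum>l\<in>A. if l = k then c k * weight ((shift ^^ m) k) else 0)"
      by (intro sum.cong refl) (auto simp: wvec_def scaleR_conv_of_real dest: injD[OF inj])
    also have "\<dots> = c k * weight ((shift ^^ m) k)"
      using k by (simp add: A_def)
    finally show ?thesis .
  qed
  have th1: "threshold s \<le> 1"
  proof -
    have "(2::real) ^ 1 \<le> 2 ^ s" using s(1) by (intro power_increasing) auto
    then have "1 / (2::real) ^ s \<le> 1 / 2 ^ 1" by (intro divide_left_mono) auto
    then show ?thesis unfolding threshold_def power_one_right by linarith
  qed
  \<comment> \<open>Smallness at the three times bounds the same coefficient \<open>c k\<close>
    against the weights at three positions.\<close>
  have c_weight: "cmod (c k) * weight ((shift ^^ m) k) \<le> 1" if k: "k \<in> A" and m: "m \<in> {0, n, 2 * n}" for k m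
  proof -
    have "cmod (c k) * weight ((shift ^^ m) k) = cmod (coord ((block_op ^^ m) x) ((shift ^^ m) k))"
      using weight_pos[of "(shift ^^ m) k"] by (simp add: coord_pow[OF k] norm_mult)
    also have "\<dots> < threshold s"
    proof (cases "m = 2 * n")
      \<comment> \<open>\<open>basis_vec 0\<close> is invisible at indices from \<open>N\<close>
        on.\<close>
      case True
      have "N > 0" by (simp add: N_def)
      then have "(shift ^^ m) k \<noteq> 0" using shift_A[OF k, of m] by linarith
      then have "coord ((block_op ^^ m) x) ((shift ^^ m) k) = coord ((block_op ^^ m) x - basis_vec 0) ((shift ^^ m) k)"
        by simp
      then show ?thesis
        using norm_coord_le[of "(block_op ^^ m) x - basis_vec 0" "(shift ^^ m) k"] step.prems(4) True
        by (simp add: s_def)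
    next
      case False
      then have "norm ((block_op ^^ m) x) < threshold s"
        using m step.prems(2,3) by (auto simp: s_def)
      then show ?thesis using norm_coord_le le_less_trans by blast
    qed
    finally show ?thesis using th1 by simp
  qed
  \<comment> \<open>If the phase has changed, \<open>cheap_progression\<close> forces one of the
    three positions to have maximal weight, and \<open>c_weight\<close> at that time bounds
    \<open>c k\<close>.\<close>
  have c_small: "cmod (c k) \<le> 2 ^ s / height s"
    if k: "k \<in> A" and m: "m \<in> {n, 2 * n}" and ne: "phase ((shift ^^ m) k) \<noteq> phase k" for k m
  proof -
    have ge: "4 ^ 12 \<le> (shift ^^ l) k" for l
      using A_ge[OF k] shift_A[OF k] A_def N_def by (metis A_ge atLeastLessThan_iff k lev_A lev_prop(2) lev_shift_pow)
    have w: "weight ((shift ^^ l) k) = profile s ((pos k + l) mod 2 ^ s)" for l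
      using ge[of l] by (simp add: weight_def lev_shift_pow pos_shift_pow[OF A_ge[OF k]] lev_A[OF k])
    have ph: "phase ((shift ^^ l) k) = (if 2 ^ (s - 2) \<le> (pos k + l) mod 2 ^ s then 1 else 0)" for l
      by (simp add: phase_def lev_shift_pow pos_shift_pow[OF A_ge[OF k]] lev_A[OF k])
    have pk: "pos k < 2 ^ s" by (simp add: pos_def lev_A[OF k])
    have "\<exists>l\<in>{0, n, 2 * n}. height s / 2 ^ s \<le> weight ((shift ^^ l) k)"
    proof (rule ccontr)
      assume "\<not> ?thesis"
      then have lt: "profile s (pos k) < height s / 2 ^ s"
        "profile s ((pos k + n) mod 2 ^ s) < height s / 2 ^ s"
        "profile s ((pos k + 2 * n) mod 2 ^ s) < height s / 2 ^ s"
        using w[of 0] w[of n] w[of "2 * n"] pk by auto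
      show False
        using cheap_progression[OF s(1) pk lt] m ne ph[of 0] ph[of n] ph[of "2 * n"] pk by auto
    qed
    then obtain l where l: "l \<in> {0, n, 2 * n}" "height s / 2 ^ s \<le> weight ((shift ^^ l) k)" by blast
    have "cmod (c k) * (height s / 2 ^ s) \<le> cmod (c k) * weight ((shift ^^ l) k)"
      using l(2) by (rule mult_left_mono) simp
    also have "\<dots> \<le> 1" by (rule c_weight[OF k l(1)])
    finally show ?thesis using height_ge_1[of s] by (simp add: field_simps)
  qed
  have I_small: "norm (I m) \<le> 1 / 2 ^ s" if m: "m \<in> {n, 2 * n}" for m
  proof -
    have hs: "0 < height s" "0 < height r" using height_ge_1[of s] height_ge_1[of r] by linarith+
    \<comment> \<open>At most \<open>4 ^ s\<close> such terms; with
      \<open>height s = (height r)\<^sup>2\<close> the total is at most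
      \<open>2 ^ (3 * s + 1) / height r\<close>, far below \<open>1 / 2 ^ s\<close>.\<close>
    have "norm (I m) \<le> (\<Sum>k\<in>A. (2 ^ s / height s) * (2 * height r))"
      unfolding I_def
    proof (rule sum_norm_le)
      fix k assume k: "k \<in> A"
      let ?d = "phase ((shift ^^ m) k) - phase k" and ?v = "(block_op ^^ (pos k + m)) (basis_vec (target k))"
      show "norm (c k *\<^sub>C (?d *\<^sub>R ?v)) \<le> (2 ^ s / height s) * (2 * height r)"
      proof (cases "?d = 0")
        case True
        then show ?thesis using hs by simp
      next
        case False
        have "(4::nat) ^ (s - 2) \<le> 4 ^ r" by (intro power_increasing) (auto simp: s_def)
        then have "target k < 4 ^ r" using target_less[OF A_ge[OF k]] lev_A[OF k] by (metis less_le_trans)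
        then have v: "norm ?v \<le> 2 * height r" using step.hyps by (intro orbit_bound) auto
        have "norm (?d *\<^sub>R ?v) \<le> 1 * (2 * height r)"
          unfolding norm_scaleR by (intro mult_mono phase_diff_le v) auto
        moreover have "cmod (c k) \<le> 2 ^ s / height s"
          using c_small[OF k m] False by simp
        ultimately show ?thesis
          unfolding norm_scaleC using hs by (intro mult_mono) auto
      qed
    qed
    also have "\<dots> \<le> 4 ^ s * ((2 ^ s / height s) * (2 * height r))"
    proof -
      have "real (card A) \<le> real (4 ^ s)" unfolding A_def of_nat_le_iff by simp
      then have "real (card A) \<le> 4 ^ s" by simp
      then show ?thesis
        unfolding sum_constant by (rule mult_right_mono) (use hs in simp)
    qed
    also have "\<dots> = 2 ^ (3 * s + 1) / height r"
    proof -
      have "(4::real) ^ s * 2 ^ s = 2 ^ (3 * s)"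
        by (simp add: power_mult flip: power_mult_distrib)
      then show ?thesis
        using hs height_square[OF s(2)] s(3) by (simp add: power2_eq_square field_simps)
    qed
    also have "\<dots> \<le> 2 ^ (3 * s + 1) / 2 ^ (5 * s + 1)"
      using height_lower[OF s(2)] hs s(3) by (intro divide_left_mono) auto
    also have "\<dots> \<le> 1 / 2 ^ s"
    proof -
      have "(2::real) ^ (3 * s + 1) * 2 ^ s = 2 ^ (4 * s + 1)"
        unfolding power_add[symmetric] by (simp add: algebra_simps)
      also have "\<dots> \<le> 2 ^ (5 * s + 1)" by (rule power_increasing) auto
      finally show ?thesis by (simp add: field_simps)
    qed
    finally show ?thesis .
  qed
  have th: "threshold r = threshold s + 1 / 2 ^ s" by (simp add: threshold_def s_def)
  have "norm y < threshold r"
  proof -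
    have "norm x < threshold s" using step.prems(2) by (simp add: s_def)
    moreover have "0 < 1 / (2::real) ^ s" by simp
    ultimately show ?thesis unfolding th y_def using norm_trunc_le[of N x] by linarith
  qed
  moreover have "norm ((block_op ^^ n) y) < threshold r"
  proof -
    have "(block_op ^^ n) y = trunc N ((block_op ^^ n) x) - I n" by (simp add: trunc_pow)
    then have "norm ((block_op ^^ n) y) \<le> norm (trunc N ((block_op ^^ n) x)) + norm (I n)"
      using norm_triangle_ineq4 by metis
    then show ?thesis
      using norm_trunc_le[of N "(block_op ^^ n) x"] step.prems(3)[folded s_def] I_small[of n] th by simp
  qed
  moreover have "norm ((block_op ^^ (2 * n)) y - basis_vec 0) < threshold r"
  proof -
    have "trunc N (basis_vec 0) = basis_vec 0"
      by (intro trunc_of_supp_below supp_below_basis_vec) (simp add: N_def)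
    then have "(block_op ^^ (2 * n)) y - basis_vec 0 = trunc N ((block_op ^^ (2 * n)) x - basis_vec 0) - I (2 * n)"
      by (simp add: trunc_pow trunc_diff)
    then have "norm ((block_op ^^ (2 * n)) y - basis_vec 0) \<le>
        norm (trunc N ((block_op ^^ (2 * n)) x - basis_vec 0)) + norm (I (2 * n))"
      using norm_triangle_ineq4 by metis
    then show ?thesis
      using norm_trunc_le[of N "(block_op ^^ (2 * n)) x - basis_vec 0"] step.prems(4)[folded s_def] I_small[of "2 * n"] th
      by simp
  qed
  ultimately show False using step.IH[of y] y by (simp add: N_def)
qed

lemma continuous_on_op_pow: "continuous_on S (block_op ^^ n)"
  by (rule linear_continuous_on[OF bounded_linear_block_op_pow])

text \<open>A return of the three balls could be realised by a finitely supported vector, which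
  \<open>no_double_return\<close> excludes. So there is no return time at all, and the empty set is
  not syndetic.\<close>

lemma not_d_syndetic_block_op: "\<not> d_syndetic [block_op, block_op ^^ 2]"
proof
  assume ds: "d_syndetic [block_op, block_op ^^ 2]"
  let ?U = "ball (0 :: ell2) (1 / 4)" and ?V = "ball (basis_vec 0) (1 / 4)"
  let ?E = "\<lambda>k. (\<Inter>i<length [block_op, block_op ^^ 2]. ([block_op, block_op ^^ 2] ! i ^^ k) -` ([?U, ?V] ! i)) \<inter> ?U"
  have "syndetic {k. ?E k \<noteq> {}}"
    using ds[unfolded d_syndetic_def, rule_format, of "[?U, ?V]" ?U] by auto
  moreover have "?E k = {}" for k
  proof -
    have E: "?E k = ?U \<inter> (block_op ^^ k) -` ?U \<inter> (block_op ^^ (2 * k)) -` ?V"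
      by (auto simp: less_Suc_eq numeral_2_eq_2 funpow_mult simp del: funpow.simps)
    have opn: "open (?U \<inter> (block_op ^^ k) -` ?U \<inter> (block_op ^^ (2 * k)) -` ?V)"
      by (intro open_Int open_ball open_vimage continuous_on_op_pow)
    show ?thesis
    proof (rule ccontr)
      assume "?E k \<noteq> {}"
      then obtain M x where x: "supp_below M x" "x \<in> ?U \<inter> (block_op ^^ k) -` ?U \<inter> (block_op ^^ (2 * k)) -` ?V"
        unfolding E using open_contains_supp_below[OF opn] by blast
      define s where "s = M + 12"
      have "M \<le> 4 ^ s" by (rule le_four_power) (simp add: s_def)
      then have "supp_below (4 ^ s) x" by (rule supp_below_mono[OF x(1)])
      moreover have "1 / 4 < threshold s" by (simp add: threshold_def)
      moreover have "norm x < 1 / 4" "norm ((block_op ^^ k) x) < 1 / 4" "norm ((block_op ^^ (2 * k)) x - basis_vec 0) < 1 / 4"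
        using x(2) by (auto simp: dist_norm norm_minus_commute)
      ultimately show False
        using no_double_return[of s x k] by (simp add: s_def)
    qed
  qed
  ultimately have "syndetic {}" by simp
  then show False by (simp add: syndetic_def)
qed

theorem theorem1p4:
  shows "\<exists>T :: ell2 \<Rightarrow> ell2.
           bounded_clinear T \<and> mixing T \<and> chaotic T \<and> \<not> d_syndetic [T, T ^^ 2]"
proof (intro exI[of _ block_op] conjI bounded_clinear_block_op mixing_block_op not_d_syndetic_block_op)
  have "hypercyclic block_op"
    using mixing_block_op continuous_on_op_pow[of UNIV 1] by (intro mixing_imp_hypercyclic) simp_all
  then show "chaotic block_op"
    using periodic_points_dense by (simp add: chaotic_def)
qed

end
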